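(* Let $\tau$ be a Hausdorff locally solid topology on a vector lattice $X$. The following are equivalent: (i) $\tau$ is $uo$-Lebesgue; (ii) $\tau$ is Lebesgue and unbounded; (iii) $\tau$ is minimal.
   Context: All vector lattices are real and Archimedean. A (not necessarily Hausdorff) topology on a vector lattice is locally solid if it is a linear topology with a base at zero of solid sets. A net $(x_\alpha)$ in $X$ order converges to $x$ ($x_\alpha\xrightarrow{o}x$) if there is a net $(y_\beta)$, possibly over a different index set, with $y_\beta\downarrow 0$ and such that for each $\beta$ there is $\alpha_0$ with $|x_\alpha-x|\le y_\beta$ for all $\alpha\ge\alpha_0$. It $uo$-converges to $x$ ($x_\alpha\xrightarrow{uo}x$) if $|x_\alpha-x|\wedge u\xrightarrow{o}0$ for every $u\in X_+$. A locally solid topology $\tau$ is Lebesgue if $x_\alpha\xrightarrow{o}0$ implies $x_\alpha\xrightarrow{\tau}0$, and $uo$-Lebesgue if $x_\alpha\xrightarrow{uo}0$ implies $x_\alpha\xrightarrow{\tau}0$ (for all nets). For a locally solid topology $\tau$, $u\tau$ denotes the locally solid topology on $X$ whose convergent nets are given by: $x_\alpha\xrightarrow{u\tau}x$ iff $|x_\alpha-x|\wedge u\xrightarrow{\tau}0$ for every $u\in X_+$; $\tau$ is unbounded if $\tau=u\tau$. A Hausdorff locally solid topology $\tau$ on $X$ is minimal if every Hausdorff locally solid topology $\tau_1$ on $X$ with $\tau_1\subseteq\tau$ satisfies $\tau_1=\tau$. *)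

theory Defs
  imports "HOL-Analysis.Analysis" "HOL-Library.Lattice_Algebras"
begin

section \<open>Vector lattices and locally solid topologies\<close>

class vector_lattice = ordered_real_vector + lattice_ab_group_add_abs

class archimedean_vector_lattice = vector_lattice +
  assumes archimedean: "0 \<le> x \<Longrightarrow> (\<And>n::nat. real n *\<^sub>R x \<le> y) \<Longrightarrow> x = 0"

definition solid :: "'a::vector_lattice set \<Rightarrow> bool" where
  "solid S \<longleftrightarrow> (\<forall>x y. x \<in> S \<and> \<bar>y\<bar> \<le> \<bar>x\<bar> \<longrightarrow> y \<in> S)"

definition linear_topology :: "'a::real_vector topology \<Rightarrow> bool" where
  "linear_topology T \<longleftrightarrow> topspace T = UNIV
     \<and> continuous_map (prod_topology T T) T (\<lambda>(x, y). x + y)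
     \<and> continuous_map (prod_topology euclideanreal T) T (\<lambda>(r, x). r *\<^sub>R x)"

definition locally_solid :: "'a::vector_lattice topology \<Rightarrow> bool" where
  "locally_solid T \<longleftrightarrow> linear_topology T \<and> neighbourhood_base_at 0 solid T"

definition minimal_topology :: "'a::vector_lattice topology \<Rightarrow> bool" where
  "minimal_topology T \<longleftrightarrow> locally_solid T \<and> Hausdorff_space T
     \<and> (\<forall>T1. locally_solid T1 \<and> Hausdorff_space T1 \<and> (\<forall>U. openin T1 U \<longrightarrow> openin T U)
          \<longrightarrow> T1 = T)"


section \<open>Nets, order convergence and unbounded order convergence\<close>

text \<open>
  A net is a function \<open>x\<close> on a nonempty set \<open>D\<close> that is directed by a preorder \<open>le\<close>;
  values of \<open>x\<close> outside \<open>D\<close> are irrelevant. Its topological convergence is \<^const>\<open>limitin\<close>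
  along the filter of tails.
\<close>

definition directed_set :: "'i set \<Rightarrow> ('i \<Rightarrow> 'i \<Rightarrow> bool) \<Rightarrow> bool" where
  "directed_set D le \<longleftrightarrow> D \<noteq> {} \<and> (\<forall>a\<in>D. le a a)
     \<and> (\<forall>a\<in>D. \<forall>b\<in>D. \<forall>c\<in>D. le a b \<longrightarrow> le b c \<longrightarrow> le a c)
     \<and> (\<forall>a\<in>D. \<forall>b\<in>D. \<exists>c\<in>D. le a c \<and> le b c)"

definition net_filter :: "'i set \<Rightarrow> ('i \<Rightarrow> 'i \<Rightarrow> bool) \<Rightarrow> 'i filter" where
  "net_filter D le = (INF a\<in>D. principal {b\<in>D. le a b})"

text \<open>
  HOL cannot quantify over index types inside a formula. Quantification over all nets in \<open>'a\<close>
  is rendered by index sets contained in the type \<open>'a set \<times> 'a\<close>. This loses nothing: see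
  \<open>net_reindex\<close>, \<open>order_convergesI\<close>, \<open>LebesgueD\<close>, \<open>uo_LebesgueD\<close> and \<open>limitin_u_topology\<close>
  below, which cover nets over an arbitrary index type.
\<close>

type_synonym 'a index = "'a set \<times> 'a"

definition decreases_to_zero ::
    "'i set \<Rightarrow> ('i \<Rightarrow> 'i \<Rightarrow> bool) \<Rightarrow> ('i \<Rightarrow> 'a::vector_lattice) \<Rightarrow> bool" where
  "decreases_to_zero D le y \<longleftrightarrow> (\<forall>a\<in>D. \<forall>b\<in>D. le a b \<longrightarrow> y b \<le> y a)
     \<and> (\<forall>a\<in>D. 0 \<le> y a) \<and> (\<forall>z. (\<forall>a\<in>D. z \<le> y a) \<longrightarrow> z \<le> 0)"

definition order_converges ::
    "'i set \<Rightarrow> ('i \<Rightarrow> 'i \<Rightarrow> bool) \<Rightarrow> ('i \<Rightarrow> 'a::vector_lattice) \<Rightarrow> 'a \<Rightarrow> bool" where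
  "order_converges D le x l \<longleftrightarrow>
     (\<exists>E leE (y :: 'a index \<Rightarrow> 'a). directed_set E leE \<and> decreases_to_zero E leE y
        \<and> (\<forall>b\<in>E. \<exists>a0\<in>D. \<forall>a\<in>D. le a0 a \<longrightarrow> \<bar>x a - l\<bar> \<le> y b))"

definition uo_converges ::
    "'i set \<Rightarrow> ('i \<Rightarrow> 'i \<Rightarrow> bool) \<Rightarrow> ('i \<Rightarrow> 'a::vector_lattice) \<Rightarrow> 'a \<Rightarrow> bool" where
  "uo_converges D le x l \<longleftrightarrow> (\<forall>u\<ge>0. order_converges D le (\<lambda>a. inf \<bar>x a - l\<bar> u) 0)"

definition Lebesgue :: "'a::vector_lattice topology \<Rightarrow> bool" where
  "Lebesgue T \<longleftrightarrow> (\<forall>D le (x :: 'a index \<Rightarrow> 'a). directed_set D le \<longrightarrow>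
     order_converges D le x 0 \<longrightarrow> limitin T x 0 (net_filter D le))"

definition uo_Lebesgue :: "'a::vector_lattice topology \<Rightarrow> bool" where
  "uo_Lebesgue T \<longleftrightarrow> (\<forall>D le (x :: 'a index \<Rightarrow> 'a). directed_set D le \<longrightarrow>
     uo_converges D le x 0 \<longrightarrow> limitin T x 0 (net_filter D le))"


section \<open>The topology \<open>u\<tau>\<close>\<close>

definition is_u_topology :: "'a::vector_lattice topology \<Rightarrow> 'a topology \<Rightarrow> bool" where
  "is_u_topology T S \<longleftrightarrow> locally_solid S
     \<and> (\<forall>D le (x :: 'a index \<Rightarrow> 'a) l. directed_set D le \<longrightarrow>
          (limitin S x l (net_filter D le) \<longleftrightarrow>
             (\<forall>u\<ge>0. limitin T (\<lambda>a. inf \<bar>x a - l\<bar> u) 0 (net_filter D le))))"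

text \<open>Existence and uniqueness are proved in \<open>ex1_u_topology\<close> below.\<close>

definition u_topology :: "'a::vector_lattice topology \<Rightarrow> 'a topology" where
  "u_topology T = (THE S. is_u_topology T S)"

definition unbounded_topology :: "'a::vector_lattice topology \<Rightarrow> bool" where
  "unbounded_topology T \<longleftrightarrow> T = u_topology T"


section \<open>Independence of the index type\<close>

lemma eventually_net_filter:
  assumes "directed_set D le"
  shows "eventually P (net_filter D le) \<longleftrightarrow> (\<exists>a\<in>D. \<forall>b\<in>D. le a b \<longrightarrow> P b)"
  unfolding net_filter_def
proof (subst eventually_INF_base)
  show "D \<noteq> {}" using assms by (auto simp: directed_set_def)
next
  fix a b assume ab: "a \<in> D" "b \<in> D"
  then obtain c where c: "c \<in> D" "le a c" "le b c"
    using assms ab unfolding directed_set_def by blast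
  have "le a d \<and> le b d" if "d \<in> D" "le c d" for d
    using assms ab c that unfolding directed_set_def by blast
  then show "\<exists>x\<in>D. principal {b \<in> D. le x b}
      \<le> inf (principal {b \<in> D. le a b}) (principal {c \<in> D. le b c})"
    using c by (intro bexI[of _ c]) auto
qed (auto simp: eventually_principal)

lemma net_reindex:
  fixes x :: "'i \<Rightarrow> 'a"
  assumes D: "directed_set D le"
  obtains D' le' and x' :: "'a index \<Rightarrow> 'a" where "directed_set D' le'"
    "filtermap x' (net_filter D' le') = filtermap x (net_filter D le)"
proof -
  define tl where "tl a = x ` {b\<in>D. le a b}" for a
  define D' where "D' = {(A, v). \<exists>a\<in>D. A = tl a \<and> v \<in> A}"
  define le' where "le' p q \<longleftrightarrow> fst q \<subseteq> fst p" for p q :: "'a index"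
  have refl: "le a a" if "a \<in> D" for a using D that unfolding directed_set_def by blast
  have trans: "le a c" if "a \<in> D" "b \<in> D" "c \<in> D" "le a b" "le b c" for a b c
    using D that unfolding directed_set_def by blast
  have mem: "(tl a, x a) \<in> D'" if "a \<in> D" for a
    using that refl[OF that] by (auto simp: D'_def tl_def)
  have dir: "directed_set D' le'"
    unfolding directed_set_def
  proof (intro conjI ballI impI)
    show "D' \<noteq> {}" using D mem unfolding directed_set_def by blast
  next
    fix p q assume pq: "p \<in> D'" "q \<in> D'"
    obtain a b where ab: "a \<in> D" "b \<in> D" "fst p = tl a" "fst q = tl b"
    proof -
      have "\<exists>a\<in>D. fst r = tl a" if "r \<in> D'" for r using that by (auto simp: D'_def)
      then show thesis using pq that by blast
    qed
    obtain c where c: "c \<in> D" "le a c" "le b c"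
      using D ab unfolding directed_set_def by blast
    have "tl c \<subseteq> tl a" "tl c \<subseteq> tl b"
      using ab c trans unfolding tl_def by blast+
    then show "\<exists>r\<in>D'. le' p r \<and> le' q r"
      using mem[OF c(1)] ab by (intro bexI[of _ "(tl c, x c)"]) (auto simp: le'_def)
  qed (auto simp: le'_def)
  have "filtermap snd (net_filter D' le') = filtermap x (net_filter D le)"
    unfolding filter_eq_iff eventually_filtermap
      eventually_net_filter[OF D] eventually_net_filter[OF dir]
  proof (intro allI iffI)
    fix P assume "\<exists>p\<in>D'. \<forall>q\<in>D'. le' p q \<longrightarrow> P (snd q)"
    then obtain p where p: "p \<in> D'" "\<forall>q\<in>D'. le' p q \<longrightarrow> P (snd q)" by blast
    then obtain a where a: "a \<in> D" "fst p = tl a" by (auto simp: D'_def)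
    have "P (x b)" if "b \<in> D" "le a b" for b
    proof -
      have "(tl a, x b) \<in> D'" using a that by (auto simp: D'_def tl_def)
      then show ?thesis using p a by (force simp: le'_def)
    qed
    then show "\<exists>a\<in>D. \<forall>b\<in>D. le a b \<longrightarrow> P (x b)" using a by blast
  next
    fix P assume "\<exists>a\<in>D. \<forall>b\<in>D. le a b \<longrightarrow> P (x b)"
    then obtain a where a: "a \<in> D" "\<forall>b\<in>D. le a b \<longrightarrow> P (x b)" by blast
    have "P (snd q)" if "q \<in> D'" "le' (tl a, x a) q" for q
    proof -
      have "snd q \<in> fst q" using that by (auto simp: D'_def)
      then have "snd q \<in> tl a" using that by (auto simp: le'_def)
      then show ?thesis using a by (auto simp: tl_def)
    qed
    then show "\<exists>p\<in>D'. \<forall>q\<in>D'. le' p q \<longrightarrow> P (snd q)" using mem[OF a(1)] by blast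
  qed
  with dir show thesis by (rule that)
qed

lemma order_convergesI:
  fixes y :: "'j \<Rightarrow> 'a::vector_lattice"
  assumes E: "directed_set E leE" and y: "decreases_to_zero E leE y"
    and dom: "\<And>b. b \<in> E \<Longrightarrow> \<exists>a0\<in>D. \<forall>a\<in>D. le a0 a \<longrightarrow> \<bar>x a - l\<bar> \<le> y b"
  shows "order_converges D le x l"
proof -
  define E' :: "'a index set" where "E' = {{}} \<times> y ` E"
  define leE' :: "'a index \<Rightarrow> 'a index \<Rightarrow> bool" where "leE' p q \<longleftrightarrow> snd q \<le> snd p" for p q
  have "\<exists>c\<in>E. y c \<le> y a \<and> y c \<le> y b" if "a \<in> E" "b \<in> E" for a b
    using E y that unfolding directed_set_def decreases_to_zero_def by meson
  note E_dir = this
  have E'_iff: "(\<forall>p\<in>E'. P p) \<longleftrightarrow> (\<forall>b\<in>E. P ({}, y b))"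
    "(\<exists>p\<in>E'. P p) \<longleftrightarrow> (\<exists>b\<in>E. P ({}, y b))" for P
    unfolding E'_def by blast+
  have "E \<noteq> {}" using E unfolding directed_set_def by blast
  then have "E' \<noteq> {}" unfolding E'_def by blast
  then have "directed_set E' leE'"
    using E_dir unfolding directed_set_def E'_iff leE'_def snd_conv by (blast intro: order_trans)
  moreover have "decreases_to_zero E' leE' snd"
    using y unfolding decreases_to_zero_def E'_iff leE'_def snd_conv by blast
  moreover have "\<forall>p\<in>E'. \<exists>a0\<in>D. \<forall>a\<in>D. le a0 a \<longrightarrow> \<bar>x a - l\<bar> \<le> snd p"
    using dom unfolding E'_iff snd_conv by blast
  ultimately show ?thesis unfolding order_converges_def by blast
qed

lemma order_converges_eventually:
  fixes x :: "'i \<Rightarrow> 'a::vector_lattice"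
  assumes "directed_set D le"
  shows "order_converges D le (\<lambda>a. f (x a)) l \<longleftrightarrow>
     (\<exists>E leE (y :: 'a index \<Rightarrow> 'a). directed_set E leE \<and> decreases_to_zero E leE y
        \<and> (\<forall>b\<in>E. eventually (\<lambda>v. \<bar>f v - l\<bar> \<le> y b) (filtermap x (net_filter D le))))"
  unfolding order_converges_def eventually_filtermap eventually_net_filter[OF assms] ..

lemma limitin_filtermap: "limitin T f l (filtermap x F) \<longleftrightarrow> limitin T (\<lambda>a. f (x a)) l F"
  by (simp add: limitin_def eventually_filtermap)

lemma LebesgueD:
  fixes x :: "'i \<Rightarrow> 'a::vector_lattice"
  assumes T: "Lebesgue T" and D: "directed_set D le" and x: "order_converges D le x 0"
  shows "limitin T x 0 (net_filter D le)"
proof -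
  obtain D' le' and x' :: "'a index \<Rightarrow> 'a" where D': "directed_set D' le'"
    and eq: "filtermap x' (net_filter D' le') = filtermap x (net_filter D le)"
    using net_reindex[OF D] by metis
  have "order_converges D' le' x' 0"
    using x order_converges_eventually[OF D, of "\<lambda>v. v" x 0]
      order_converges_eventually[OF D', of "\<lambda>v. v" x' 0] by (simp add: eq)
  then have "limitin T x' 0 (net_filter D' le')" using T D' by (simp add: Lebesgue_def)
  then show ?thesis
    using limitin_filtermap[of T "\<lambda>v. v" 0 x'] limitin_filtermap[of T "\<lambda>v. v" 0 x] eq by metis
qed

lemma uo_LebesgueD:
  fixes x :: "'i \<Rightarrow> 'a::vector_lattice"
  assumes T: "uo_Lebesgue T" and D: "directed_set D le" and x: "uo_converges D le x 0"
  shows "limitin T x 0 (net_filter D le)"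
proof -
  obtain D' le' and x' :: "'a index \<Rightarrow> 'a" where D': "directed_set D' le'"
    and eq: "filtermap x' (net_filter D' le') = filtermap x (net_filter D le)"
    using net_reindex[OF D] by metis
  have "uo_converges D' le' x' 0"
    unfolding uo_converges_def
  proof (intro allI impI)
    fix u :: 'a assume "0 \<le> u"
    then have "order_converges D le (\<lambda>a. inf \<bar>x a - 0\<bar> u) 0" using x by (simp add: uo_converges_def)
    then show "order_converges D' le' (\<lambda>a. inf \<bar>x' a - 0\<bar> u) 0"
      using order_converges_eventually[OF D, of "\<lambda>v. inf \<bar>v - 0\<bar> u" x 0]
        order_converges_eventually[OF D', of "\<lambda>v. inf \<bar>v - 0\<bar> u" x' 0] by (simp only: eq)
  qed
  then have "limitin T x' 0 (net_filter D' le')" using T D' by (simp add: uo_Lebesgue_def)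
  then show ?thesis
    using limitin_filtermap[of T "\<lambda>v. v" 0 x'] limitin_filtermap[of T "\<lambda>v. v" 0 x] eq by metis
qed


section \<open>Existence and uniqueness of \<open>u\<tau>\<close>\<close>

lemma topology_eq_if_nets_converge:
  fixes S1 S2 :: "'a topology"
  assumes top: "topspace S1 = UNIV" "topspace S2 = UNIV"
    and conv: "\<And>D le (x :: 'a index \<Rightarrow> 'a) l. directed_set D le \<Longrightarrow>
      limitin S2 x l (net_filter D le) \<Longrightarrow> limitin S1 x l (net_filter D le)"
    and U: "openin S1 U"
  shows "openin S2 U"
proof (subst openin_subopen, rule ballI, rule ccontr)
  fix l assume l: "l \<in> U" and no: "\<nexists>W. openin S2 W \<and> l \<in> W \<and> W \<subseteq> U"
  define D where "D = {(A, v). openin S2 A \<and> l \<in> A \<and> v \<in> A - U}"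
  define le where "le p q \<longleftrightarrow> fst q \<subseteq> fst p" for p q :: "'a index"
  have ex: "\<exists>v. (A, v) \<in> D" if "openin S2 A" "l \<in> A" for A
    using no that by (auto simp: D_def)
  have D: "directed_set D le"
    unfolding directed_set_def
  proof (intro conjI ballI impI)
    show "D \<noteq> {}" using ex[of UNIV] openin_topspace[of S2] top by auto
  next
    fix p q assume "p \<in> D" "q \<in> D"
    then have "openin S2 (fst p \<inter> fst q)" "l \<in> fst p \<inter> fst q" by (auto simp: D_def)
    from ex[OF this] obtain v where "(fst p \<inter> fst q, v) \<in> D" ..
    then show "\<exists>r\<in>D. le p r \<and> le q r"
      by (intro bexI[of _ "(fst p \<inter> fst q, v)"]) (auto simp: le_def)
  qed (auto simp: le_def)
  have "limitin S2 snd l (net_filter D le)"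
    unfolding limitin_def eventually_net_filter[OF D]
  proof (intro conjI allI impI)
    fix A assume "openin S2 A \<and> l \<in> A"
    then obtain v where "(A, v) \<in> D" using ex by blast
    then show "\<exists>p\<in>D. \<forall>q\<in>D. le p q \<longrightarrow> snd q \<in> A"
      by (intro bexI[of _ "(A, v)"]) (auto simp: D_def le_def)
  qed (simp add: top)
  then have "limitin S1 snd l (net_filter D le)" by (rule conv[OF D])
  then obtain p where "p \<in> D" "\<forall>q\<in>D. le p q \<longrightarrow> snd q \<in> U"
    using U l unfolding limitin_def eventually_net_filter[OF D] by blast
  then show False by (auto simp: D_def le_def)
qed

lemma abs_scaleR_le:
  fixes x :: "'a::vector_lattice"
  assumes "\<bar>s\<bar> \<le> n"
  shows "\<bar>s *\<^sub>R x\<bar> \<le> n *\<^sub>R \<bar>x\<bar>"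
proof (rule abs_leI)
  have *: "s *\<^sub>R z \<le> \<bar>s\<bar> *\<^sub>R \<bar>z\<bar>" for s and z :: 'a
  proof (cases "0 \<le> s")
    case True then show ?thesis using scaleR_left_mono[OF abs_ge_self, of s z] by simp
  next
    case False
    have "(-s) *\<^sub>R (-z) \<le> (-s) *\<^sub>R \<bar>z\<bar>"
      using False by (intro scaleR_left_mono) (auto intro: abs_ge_minus_self)
    then show ?thesis using False by simp
  qed
  have n: "abs s *\<^sub>R abs x \<le> n *\<^sub>R abs x" using assms by (intro scaleR_right_mono) auto
  show "s *\<^sub>R x \<le> n *\<^sub>R \<bar>x\<bar>" using *[of s x] n by (rule order_trans)
  show "- (s *\<^sub>R x) \<le> n *\<^sub>R \<bar>x\<bar>" using *[of "-s" x] n by simp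
qed

lemma inf_scaleR_le:
  fixes x u :: "'a::vector_lattice"
  assumes "1 \<le> n" "0 \<le> u"
  shows "inf (n *\<^sub>R x) u \<le> n *\<^sub>R inf x u"
proof -
  let ?w = "inf (n *\<^sub>R x) u"
  have "(1/n) *\<^sub>R ?w \<le> (1/n) *\<^sub>R (n *\<^sub>R x)"
    using assms by (intro scaleR_left_mono) auto
  then have 1: "(1/n) *\<^sub>R ?w \<le> x" using assms by simp
  have "(1/n) *\<^sub>R ?w \<le> (1/n) *\<^sub>R u"
    using assms by (intro scaleR_left_mono) auto
  also have "\<dots> \<le> 1 *\<^sub>R u" using assms by (intro scaleR_right_mono) auto
  finally have 2: "(1/n) *\<^sub>R ?w \<le> u" by simp
  have "n *\<^sub>R ((1/n) *\<^sub>R ?w) \<le> n *\<^sub>R inf x u"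
    using assms 1 2 by (intro scaleR_left_mono) auto
  then show ?thesis using assms by simp
qed

lemma inf_abs_add_le:
  fixes x y u :: "'a::vector_lattice"
  assumes "0 \<le> u"
  shows "inf (abs (x + y)) u \<le> inf (abs (x)) u + inf (abs (y)) u"
proof -
  have "inf (abs (x + y)) u \<le> (abs (x)) + (abs (y))" by (meson abs_triangle_ineq le_infI1)
  moreover have "inf (abs (x + y)) u \<le> (abs (x)) + u" "inf (abs (x + y)) u \<le> u + (abs (y))" "inf (abs (x + y)) u \<le> u + u"
    using assms by (auto intro!: le_infI2)
  ultimately show ?thesis
    by (simp add: add_inf_distrib_left add_inf_distrib_right)
qed

lemma continuous_map_prod_nhds:
  assumes "continuous_map (prod_topology X Y) Z f" "openin Z W" "f (a, b) \<in> W"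
    "a \<in> topspace X" "b \<in> topspace Y"
  obtains A B where "openin X A" "openin Y B" "a \<in> A" "b \<in> B" "\<And>x y. x \<in> A \<Longrightarrow> y \<in> B \<Longrightarrow> f (x, y) \<in> W"
proof -
  have "openin (prod_topology X Y) {p \<in> topspace (prod_topology X Y). f p \<in> W}"
    by (rule openin_continuous_map_preimage[OF assms(1,2)])
  moreover have "(a, b) \<in> {p \<in> topspace (prod_topology X Y). f p \<in> W}" using assms by simp
  ultimately obtain A B where "openin X A" "openin Y B" "a \<in> A" "b \<in> B"
    "A \<times> B \<subseteq> {p \<in> topspace (prod_topology X Y). f p \<in> W}"
    unfolding openin_prod_topology_alt by meson
  then show thesis using that[of A B] by blast
qed

lemma ex_u_topology:
  fixes T :: "'a::vector_lattice topology"
  assumes T: "locally_solid T"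
  obtains S where "locally_solid S"
    "\<And>l F. limitin S (\<lambda>v. v) l F \<longleftrightarrow> (\<forall>u\<ge>0. limitin T (\<lambda>v. inf \<bar>v - l\<bar> u) 0 F)"
proof -
  have top[simp]: "topspace T = UNIV"
    and add: "continuous_map (prod_topology T T) T (\<lambda>(x, y). x + y)"
    and scale: "continuous_map (prod_topology euclideanreal T) T (\<lambda>(r, x). r *\<^sub>R x)"
    and base: "neighbourhood_base_at 0 solid T"
    using T by (auto simp: locally_solid_def linear_topology_def)
  define nb where "nb V \<longleftrightarrow> solid V \<and> (\<exists>W. openin T W \<and> 0 \<in> W \<and> W \<subseteq> V)" for V
  have nb_base: "\<exists>V. nb V \<and> V \<subseteq> W" if "openin T W" "0 \<in> W" for W
    using base that unfolding neighbourhood_base_at_def nb_def by meson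
  have nb_solid: "y \<in> V" if "nb V" "x \<in> V" "\<bar>y\<bar> \<le> \<bar>x\<bar>" for V x y
    using that unfolding nb_def solid_def by blast
  have nb_0: "0 \<in> V" if "nb V" for V using that by (auto simp: nb_def)
  have nb_Int: "nb (V \<inter> V')" if "nb V" "nb V'" for V V'
  proof -
    obtain W W' where "openin T W" "0 \<in> W" "W \<subseteq> V" "openin T W'" "0 \<in> W'" "W' \<subseteq> V'"
      using \<open>nb V\<close> \<open>nb V'\<close> unfolding nb_def by metis
    moreover have "solid (V \<inter> V')" using that unfolding nb_def solid_def by blast
    ultimately show ?thesis unfolding nb_def by (intro conjI exI[of _ "W \<inter> W'"]) auto
  qed
  have nb_half: "\<exists>V'. nb V' \<and> (\<forall>x\<in>V'. \<forall>y\<in>V'. x + y \<in> V)" if V: "nb V" for V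
  proof -
    obtain W where W: "openin T W" "0 \<in> W" "W \<subseteq> V" using V by (auto simp: nb_def)
    obtain A B where AB: "openin T A" "openin T B" "0 \<in> A" "0 \<in> B"
      "\<And>x y. x \<in> A \<Longrightarrow> y \<in> B \<Longrightarrow> (\<lambda>(x, y). x + y) (x, y) \<in> W"
      using continuous_map_prod_nhds[OF add W(1), of 0 0] W(2) by auto
    obtain V' where "nb V'" "V' \<subseteq> A \<inter> B" using nb_base[of "A \<inter> B"] AB by auto
    moreover have "x + y \<in> V" if "x \<in> V'" "y \<in> V'" for x y
      using AB(5)[of x y] that W(3) \<open>V' \<subseteq> A \<inter> B\<close> by auto
    ultimately show ?thesis by blast
  qed
  have nb_scale: "\<exists>A B. open A \<and> r \<in> A \<and> openin T B \<and> x \<in> B \<and> (\<forall>s\<in>A. \<forall>y\<in>B. s *\<^sub>R y \<in> W)"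
    if W: "openin T W" "r *\<^sub>R x \<in> W" for r x W
  proof -
    obtain A B where AB: "openin euclideanreal A" "openin T B" "r \<in> A" "x \<in> B"
      "\<And>s y. s \<in> A \<Longrightarrow> y \<in> B \<Longrightarrow> (\<lambda>(r, x). r *\<^sub>R x) (s, y) \<in> W"
      using continuous_map_prod_nhds[OF scale W(1), of r x] W(2) by auto
    then show ?thesis by (intro exI[of _ A] exI[of _ B]) auto
  qed

  define N where "N V u = {x. inf \<bar>x\<bar> u \<in> V}" for V and u :: 'a
  have absinf: "abs (inf (abs x) u) = inf (abs x) u" if "0 \<le> u" for x u :: 'a
    by (rule abs_of_nonneg) (rule le_infI[OF abs_ge_zero that])
  have N_solid: "solid (N V u)" if "nb V" "0 \<le> u" for V u
    unfolding solid_def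
  proof (intro allI impI)
    fix x y assume xy: "x \<in> N V u \<and> \<bar>y\<bar> \<le> \<bar>x\<bar>"
    then have "inf (abs y) u \<le> inf (abs x) u" by (blast intro: inf_mono)
    then show "y \<in> N V u"
      using nb_solid[OF that(1), of "inf (abs x) u" "inf (abs y) u"] xy that(2)
      by (simp add: N_def absinf)
  qed
  have N_0: "0 \<in> N V u" if "nb V" "0 \<le> u" for V u
    using that nb_0 by (auto simp: N_def inf_absorb1)
  have N_Int: "N (V \<inter> V') (sup u u') \<subseteq> N V u \<inter> N V' u'"
    if "nb V" "nb V'" "0 \<le> u" "0 \<le> u'" for V V' u u'
  proof (intro subsetI IntI)
    fix x assume x: "x \<in> N (V \<inter> V') (sup u u')"
    have s: "0 \<le> sup u u'" using that by (simp add: le_supI1)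
    have "inf (abs x) u \<le> inf (abs x) (sup u u')" "inf (abs x) u' \<le> inf (abs x) (sup u u')"
      by (auto intro: le_infI2)
    then show "x \<in> N V u" "x \<in> N V' u'"
      using x that s nb_solid[OF that(1), of "inf \<bar>x\<bar> (sup u u')" "inf \<bar>x\<bar> u"]
        nb_solid[OF that(2), of "inf \<bar>x\<bar> (sup u u')" "inf \<bar>x\<bar> u'"]
      by (auto simp: N_def absinf)
  qed
  have N_half: "\<exists>V'. nb V' \<and> (\<forall>x\<in>N V' u. \<forall>y\<in>N V' u. x + y \<in> N V u)"
    if V: "nb V" and u: "0 \<le> u" for V u
  proof -
    obtain V' where V': "nb V'" "\<forall>x\<in>V'. \<forall>y\<in>V'. x + y \<in> V" using nb_half[OF V] by auto
    have "x + y \<in> N V u" if "x \<in> N V' u" "y \<in> N V' u" for x y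
    proof -
      have "inf (abs x) u + inf (abs y) u \<in> V" using V' that by (auto simp: N_def)
      moreover have "abs (inf (abs (x + y)) u) \<le> abs (inf (abs x) u + inf (abs y) u)"
        using inf_abs_add_le[OF u, of x y] u by (simp add: abs_of_nonneg)
      ultimately show ?thesis using nb_solid[OF V] by (auto simp: N_def)
    qed
    then show ?thesis using V' by blast
  qed

  define op where "op U \<longleftrightarrow>
    (\<forall>x\<in>U. \<exists>V u. nb V \<and> 0 \<le> u \<and> (\<forall>y. y - x \<in> N V u \<longrightarrow> y \<in> U))" for U
  have istop: "istopology op"
    unfolding istopology_def
  proof (intro conjI allI impI)
    fix U U' assume U: "op U" "op U'"
    show "op (U \<inter> U')"
      unfolding op_def
    proof
      fix x assume "x \<in> U \<inter> U'"
      then obtain V u V' u' where "nb V" "0 \<le> u" "\<forall>y. y - x \<in> N V u \<longrightarrow> y \<in> U"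
        "nb V'" "0 \<le> u'" "\<forall>y. y - x \<in> N V' u' \<longrightarrow> y \<in> U'"
        using U unfolding op_def by (metis IntD1 IntD2)
      then show "\<exists>V u. nb V \<and> 0 \<le> u \<and> (\<forall>y. y - x \<in> N V u \<longrightarrow> y \<in> U \<inter> U')"
        using N_Int[of V V' u u'] nb_Int[of V V']
        by (intro exI[of _ "V \<inter> V'"] exI[of _ "sup u u'"]) (auto simp: le_supI1)
    qed
  next
    fix K assume "\<forall>U\<in>K. op U"
    then show "op (\<Union>K)" unfolding op_def by (meson Union_iff)
  qed
  define S where "S = topology op"
  have S: "openin S U \<longleftrightarrow> op U" for U by (simp add: S_def topology_inverse' istop)
  have opD: "\<exists>V u. nb V \<and> 0 \<le> u \<and> (\<forall>y. y - x \<in> N V u \<longrightarrow> y \<in> U)"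
    if "openin S U" "x \<in> U" for U x
    using that(1)[unfolded S op_def] that(2) by (rule bspec)
  have nbUNIV: "nb UNIV"
    unfolding nb_def solid_def using openin_topspace[of T] by auto
  have topS[simp]: "topspace S = UNIV"
  proof -
    have "op UNIV" using nbUNIV unfolding op_def by blast
    then show ?thesis using openin_subset[of S UNIV] S by auto
  qed
  have op_inner: "\<exists>U. openin S U \<and> x \<in> U \<and> (\<forall>y\<in>U. y - x \<in> N V u)"
    if "nb V" "0 \<le> u" for V u x
  proof -
    define U where
      "U = {z. \<exists>V' u'. nb V' \<and> 0 \<le> u' \<and> (\<forall>y. y - z \<in> N V' u' \<longrightarrow> y - x \<in> N V u)}"
    have "op U"
      unfolding op_def
    proof
      fix z assume "z \<in> U"
      then obtain V' u' where V': "nb V'" "0 \<le> u'" "\<forall>y. y - z \<in> N V' u' \<longrightarrow> y - x \<in> N V u"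
        by (auto simp: U_def)
      obtain V'' where V'': "nb V''" "\<forall>x\<in>N V'' u'. \<forall>y\<in>N V'' u'. x + y \<in> N V' u'"
        using N_half V' by meson
      have "w \<in> U" if w: "w - z \<in> N V'' u'" for w
      proof -
        have "y - x \<in> N V u" if "y - w \<in> N V'' u'" for y
        proof -
          have "(y - w) + (w - z) \<in> N V' u'" using V'' w that by blast
          then show ?thesis using V' by simp
        qed
        then show ?thesis using V'' V' unfolding U_def by blast
      qed
      then show "\<exists>V u. nb V \<and> 0 \<le> u \<and> (\<forall>y. y - z \<in> N V u \<longrightarrow> y \<in> U)"
        using V'' V' by blast
    qed
    moreover have "x \<in> U" using that by (auto simp: U_def)
    moreover have "y - x \<in> N V u" if "y \<in> U" for y
    proof -
      obtain V' u' where V': "nb V'" "0 \<le> u'" "\<forall>w. w - y \<in> N V' u' \<longrightarrow> w - x \<in> N V u"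
        using \<open>y \<in> U\<close> by (auto simp: U_def)
      then show ?thesis using N_0[of V' u'] by (metis diff_self)
    qed
    ultimately show ?thesis using S by blast
  qed

  have addS: "continuous_map (prod_topology S S) S (\<lambda>(x, y). x + y)"
    unfolding continuous_map
  proof (intro conjI allI impI)
    fix U assume U: "openin S U"
    show "openin (prod_topology S S) {p \<in> topspace (prod_topology S S). (\<lambda>(x, y). x + y) p \<in> U}"
      unfolding openin_prod_topology_alt
    proof (intro allI impI)
      fix a b assume "(a, b) \<in> {p \<in> topspace (prod_topology S S). (\<lambda>(x, y). x + y) p \<in> U}"
      then have "a + b \<in> U" by auto
      then obtain V u where V: "nb V" "0 \<le> u" "\<forall>y. y - (a + b) \<in> N V u \<longrightarrow> y \<in> U"
        using opD[OF U] by meson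
      obtain V' where V': "nb V'" "\<forall>x\<in>N V' u. \<forall>y\<in>N V' u. x + y \<in> N V u"
        using N_half V by meson
      obtain A where A: "openin S A" "a \<in> A" "\<forall>y\<in>A. y - a \<in> N V' u" using op_inner V' V by meson
      obtain B where B: "openin S B" "b \<in> B" "\<forall>y\<in>B. y - b \<in> N V' u" using op_inner V' V by meson
      have "x + y \<in> U" if "x \<in> A" "y \<in> B" for x y
      proof -
        have "(x - a) + (y - b) \<in> N V u" using A B V' that by blast
        then show ?thesis using V by (simp add: algebra_simps)
      qed
      then show "\<exists>A B. openin S A \<and> openin S B \<and> a \<in> A \<and> b \<in> B \<and>
          A \<times> B \<subseteq> {p \<in> topspace (prod_topology S S). (\<lambda>(x, y). x + y) p \<in> U}"
        using A B by (intro exI[of _ A] exI[of _ B]) auto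
    qed
  qed auto

  have scaleS: "continuous_map (prod_topology euclideanreal S) S (\<lambda>(r, x). r *\<^sub>R x)"
    unfolding continuous_map
  proof (intro conjI allI impI)
    fix U assume U: "openin S U"
    let ?P = "{p \<in> topspace (prod_topology euclideanreal S). (\<lambda>(r, x). r *\<^sub>R x) p \<in> U}"
    show "openin (prod_topology euclideanreal S) ?P"
      unfolding openin_prod_topology_alt
    proof (intro allI impI)
      fix r x assume "(r, x) \<in> ?P"
      then have "r *\<^sub>R x \<in> U" by auto
      then obtain V u where V: "nb V" "0 \<le> u" "\<forall>y. y - r *\<^sub>R x \<in> N V u \<longrightarrow> y \<in> U"
        using opD[OF U] by meson
      obtain V' where V': "nb V'" "\<forall>x\<in>N V' u. \<forall>y\<in>N V' u. x + y \<in> N V u"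
        using N_half V by meson
      obtain W where W: "openin T W" "0 \<in> W" "W \<subseteq> V'" using V' by (auto simp: nb_def)
      obtain I0 where I0: "open I0" "(0::real) \<in> I0" "\<forall>t\<in>I0. t *\<^sub>R x \<in> W"
        using nb_scale[OF W(1), of 0 x] W(2) by auto
      obtain e where e: "0 < e" "ball 0 e \<subseteq> I0"
        using openE[OF I0(1,2)] by metis
      define I where "I = ball r (min e 1)"
      define n where "n = \<bar>r\<bar> + 1"
      obtain B0 where B0: "openin T B0" "0 \<in> B0" "\<forall>y\<in>B0. n *\<^sub>R y \<in> W"
        using nb_scale[OF W(1), of n 0] W(2) by auto
      obtain V'' where V'': "nb V''" "V'' \<subseteq> B0" using nb_base[OF B0(1,2)] by auto
      obtain B where B: "openin S B" "x \<in> B" "\<forall>y\<in>B. y - x \<in> N V'' u"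
        using op_inner V'' V by meson
      have "s *\<^sub>R y \<in> U" if s: "s \<in> I" and y: "y \<in> B" for s y
      proof -
        have sr: "\<bar>s - r\<bar> < e" "\<bar>s\<bar> \<le> n"
          using s by (auto simp: I_def n_def dist_real_def)
        have "s - r \<in> I0" using e sr by (auto simp: dist_real_def)
        then have inV': "(s - r) *\<^sub>R x \<in> V'" using I0 W by blast
        have "inf \<bar>(s - r) *\<^sub>R x\<bar> u \<in> V'"
          by (rule nb_solid[OF V'(1) inV']) (simp add: absinf V)
        then have 1: "(s - r) *\<^sub>R x \<in> N V' u" by (simp add: N_def)
        have "n *\<^sub>R inf \<bar>y - x\<bar> u \<in> V'"
          using B y V'' B0 W by (auto simp: N_def)
        moreover have "abs (inf (abs (s *\<^sub>R (y - x))) u) \<le> abs (n *\<^sub>R inf (abs (y - x)) u)"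
        proof -
          have "inf \<bar>s *\<^sub>R (y - x)\<bar> u \<le> inf (n *\<^sub>R \<bar>y - x\<bar>) u"
            using abs_scaleR_le[OF sr(2), of "y - x"] by (rule inf_mono) simp
          also have "\<dots> \<le> n *\<^sub>R inf \<bar>y - x\<bar> u"
            using V by (intro inf_scaleR_le) (auto simp: n_def)
          also have "\<dots> \<le> abs (n *\<^sub>R inf (abs (y - x)) u)" by (rule abs_ge_self)
          finally show ?thesis using V by (simp add: absinf)
        qed
        ultimately have "inf \<bar>s *\<^sub>R (y - x)\<bar> u \<in> V'" by (rule nb_solid[OF V'(1)])
        then have 2: "s *\<^sub>R (y - x) \<in> N V' u" by (simp add: N_def)
        have "s *\<^sub>R (y - x) + (s - r) *\<^sub>R x \<in> N V u" using 1 2 V' by blast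
        then show ?thesis using V by (simp add: algebra_simps)
      qed
      moreover have "openin euclideanreal I" "r \<in> I" using e by (auto simp: I_def)
      ultimately show "\<exists>A B. openin euclideanreal A \<and> openin S B \<and> r \<in> A \<and> x \<in> B \<and> A \<times> B \<subseteq> ?P"
        using B by (intro exI[of _ I] exI[of _ B]) auto
    qed
  qed auto

  have baseS: "neighbourhood_base_at 0 solid S"
    unfolding neighbourhood_base_at_def
  proof (intro allI impI)
    fix W assume "openin S W \<and> 0 \<in> W"
    then obtain V u where V: "nb V" "0 \<le> u" "\<forall>y. y - 0 \<in> N V u \<longrightarrow> y \<in> W"
      using opD by meson
    obtain U where "openin S U" "0 \<in> U" "\<forall>y\<in>U. y - 0 \<in> N V u" using op_inner V by meson
    then show "\<exists>U V. openin S U \<and> solid V \<and> 0 \<in> U \<and> U \<subseteq> V \<and> V \<subseteq> W"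
      using V N_solid[OF V(1,2)] by (intro exI[of _ U] exI[of _ "N V u"]) auto
  qed

  have limS: "limitin S (\<lambda>v. v) l F \<longleftrightarrow> (\<forall>u\<ge>0. limitin T (\<lambda>v. inf \<bar>v - l\<bar> u) 0 F)" for l F
  proof (intro iffI allI impI)
    fix u :: 'a
    assume lim: "limitin S (\<lambda>v. v) l F" and u: "0 \<le> u"
    show "limitin T (\<lambda>v. inf \<bar>v - l\<bar> u) 0 F"
      unfolding limitin_def
    proof (intro conjI allI impI)
      fix U assume U: "openin T U \<and> 0 \<in> U"
      obtain V where V: "nb V" "V \<subseteq> U" using nb_base U by blast
      obtain A where A: "openin S A" "l \<in> A" "\<forall>y\<in>A. y - l \<in> N V u" using op_inner V u by meson
      have "eventually (\<lambda>v. v \<in> A) F" using lim A by (auto simp: limitin_def)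
      then show "eventually (\<lambda>v. inf \<bar>v - l\<bar> u \<in> U) F"
        by (rule eventually_mono) (use A V in \<open>auto simp: N_def\<close>)
    qed simp
  next
    assume lim: "\<forall>u\<ge>0. limitin T (\<lambda>v. inf \<bar>v - l\<bar> u) 0 F"
    show "limitin S (\<lambda>v. v) l F"
      unfolding limitin_def
    proof (intro conjI allI impI)
      fix U assume "openin S U \<and> l \<in> U"
      then obtain V u where V: "nb V" "0 \<le> u" "\<forall>y. y - l \<in> N V u \<longrightarrow> y \<in> U"
        using opD by meson
      obtain W where W: "openin T W" "0 \<in> W" "W \<subseteq> V" using V by (auto simp: nb_def)
      have "eventually (\<lambda>v. inf \<bar>v - l\<bar> u \<in> W) F" using lim W V by (auto simp: limitin_def)
      then show "eventually (\<lambda>v. v \<in> U) F"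
        by (rule eventually_mono) (use W V in \<open>auto simp: N_def\<close>)
    qed simp
  qed
  show thesis
  proof
    show "locally_solid S"
      using addS scaleS baseS by (simp add: locally_solid_def linear_topology_def)
  qed (rule limS)
qed

lemma u_topology_exists:
  fixes T :: "'a::vector_lattice topology"
  assumes "locally_solid T"
  obtains S where "is_u_topology T S"
    "\<And>l F. limitin S (\<lambda>v. v) l F \<longleftrightarrow> (\<forall>u\<ge>0. limitin T (\<lambda>v. inf \<bar>v - l\<bar> u) 0 F)"
proof -
  obtain S where S: "locally_solid S"
    "\<And>l F. limitin S (\<lambda>v. v) l F \<longleftrightarrow> (\<forall>u\<ge>0. limitin T (\<lambda>v. inf \<bar>v - l\<bar> u) 0 F)"
    using ex_u_topology[OF assms] by metis
  have "limitin S x l (net_filter D le) \<longleftrightarrow>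
      (\<forall>u\<ge>0. limitin T (\<lambda>a. inf \<bar>x a - l\<bar> u) 0 (net_filter D le))"
    for D le l and x :: "'a index \<Rightarrow> 'a"
    using S(2)[of l "filtermap x (net_filter D le)"] by (simp add: limitin_filtermap)
  then have "is_u_topology T S" using S(1) by (simp add: is_u_topology_def)
  then show thesis using S(2) by (rule that)
qed

lemma is_u_topology_unique:
  assumes "is_u_topology T S1" "is_u_topology T S2"
  shows "S1 = S2"
proof -
  have "topspace S1 = UNIV" "topspace S2 = UNIV"
    using assms by (auto simp: is_u_topology_def locally_solid_def linear_topology_def)
  then have "openin S1 U \<longleftrightarrow> openin S2 U" for U
    using topology_eq_if_nets_converge[of S1 S2 U] topology_eq_if_nets_converge[of S2 S1 U] assms
    by (auto simp: is_u_topology_def)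
  then show ?thesis by (simp add: topology_eq)
qed

lemma ex1_u_topology: "locally_solid T \<Longrightarrow> \<exists>!S. is_u_topology T S"
  using is_u_topology_unique u_topology_exists by metis

lemma is_u_topology_u_topology: "locally_solid T \<Longrightarrow> is_u_topology T (u_topology T)"
  unfolding u_topology_def by (rule theI') (rule ex1_u_topology)

lemma limitin_u_topology:
  fixes x :: "'i \<Rightarrow> 'a::vector_lattice"
  assumes "locally_solid T"
  shows "limitin (u_topology T) x l F \<longleftrightarrow> (\<forall>u\<ge>0. limitin T (\<lambda>a. inf \<bar>x a - l\<bar> u) 0 F)"
proof -
  obtain S where S: "is_u_topology T S"
    "\<And>l F. limitin S (\<lambda>v. v) l F \<longleftrightarrow> (\<forall>u\<ge>0. limitin T (\<lambda>v. inf \<bar>v - l\<bar> u) 0 F)"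
    using u_topology_exists[OF assms] by metis
  have "u_topology T = S"
    using is_u_topology_unique is_u_topology_u_topology[OF assms] S(1) by metis
  then show ?thesis
    using S(2)[of l "filtermap x F"] by (simp add: limitin_filtermap)
qed

end

theory Submission
  imports Defs
begin

text \<open>
  We show uo-Lebesgue \<open>\<Longrightarrow>\<close> minimal \<open>\<Longrightarrow>\<close> Lebesgue and unbounded \<open>\<Longrightarrow>\<close> uo-Lebesgue, without passing to
  completions.

  Let \<open>\<tau>\<close> be uo-Lebesgue and \<open>\<tau>\<^sub>1\<close> a coarser Hausdorff locally solid topology; \<open>\<tau>\<^sub>1\<close> is Lebesgue. If
  some \<open>\<tau>\<close>-neighbourhood of zero is no \<open>\<tau>\<^sub>1\<close>-neighbourhood, a diagonal construction yields a normal
  sequence \<open>U\<^sub>n\<close> of \<open>\<tau>\<^sub>1\<close>-neighbourhoods (\<open>U\<^sub>n\<^sub>+\<^sub>1 + U\<^sub>n\<^sub>+\<^sub>1 \<subseteq> U\<^sub>n\<close>) and positive \<open>q\<^sub>n \<in> U\<^sub>n\<close>, disjoint from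
  \<open>\<Inter>U\<^sub>n\<close> and bounded away from zero in \<open>\<tau>\<close>. The Lebesgue property of \<open>\<tau>\<^sub>1\<close> forces \<open>q\<^sub>n\<close> to be uo-null, a
  contradiction.

  Let \<open>\<tau>\<close> be minimal and \<open>y \<down> 0\<close>. For fixed \<open>x = y\<^sub>b\<close> and \<open>e > 0\<close>, the positive elements that are
  eventually disjoint from \<open>(y - e x)\<^sup>+\<close> form an order dense ideal. Its unbounded topology is therefore
  Hausdorff, so it is \<open>\<tau>\<close>, and trivially \<open>(y - e x)\<^sup>+\<close> is null for it. Hence \<open>y\<close> is \<open>\<tau>\<close>-null.
\<close>

section \<open>Disjoint positive elements\<close>

lemma disjoint_add_le:
  fixes a b c :: "'a::vector_lattice"
  assumes "inf a b = 0" "a \<le> c" "b \<le> c"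
  shows "a + b \<le> c"
  using add_eq_inf_sup[of a b] assms by simp

lemma inf_add_le:
  fixes a b c :: "'a::vector_lattice"
  assumes "0 \<le> a" "0 \<le> b" "0 \<le> c"
  shows "inf c (a + b) \<le> inf c a + inf c b"
  using inf_abs_add_le[OF assms(3), of a b] assms by (simp add: abs_of_nonneg inf_commute)

lemma inf_eq_0_mono:
  fixes a b c d :: "'a::vector_lattice"
  assumes "inf a b = 0" "0 \<le> c" "0 \<le> d" "c \<le> a" "d \<le> b"
  shows "inf c d = 0"
  using inf_mono[OF assms(4,5)] assms by (intro antisym) auto

lemma inf_add_eq_0:
  fixes a b c :: "'a::vector_lattice"
  assumes "0 \<le> a" "0 \<le> b" "0 \<le> c" "inf c a = 0" "inf c b = 0"
  shows "inf c (a + b) = 0"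
  using inf_add_le[OF assms(1-3)] assms by (intro antisym) auto

text \<open>The two terms equal \<open>a - inf a b\<close> and \<open>b - inf a b\<close>, and
  infima commute with translation.\<close>

lemma inf_pos_neg_parts_eq_0:
  fixes a b :: "'a::vector_lattice"
  shows "inf (sup (a - b) 0) (sup (b - a) 0) = 0"
proof -
  have *: "sup (a - b) 0 = a - inf a b" for a b :: 'a
    by (simp add: neg_inf_eq_sup add_sup_distrib_left sup_commute flip: add_uminus_conv_diff)
  have "inf (a - inf a b) (b - inf a b) = inf a b - inf a b"
    by (metis diff_conv_add_uminus add_inf_distrib_right)
  then show ?thesis using *[of a b] *[of b a] by (simp add: inf_commute)
qed

text \<open>By induction \<open>P\<close> holds at \<open>y\<close> minus any multiple of
  \<open>x\<close>, so all multiples of \<open>x\<close> stay below \<open>y - z\<close>. This is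
  the form in which the Archimedean property enters: a candidate lower bound that can be subtracted
  again and again must vanish.\<close>

lemma multiples_bounded_imp_zero:
  fixes x y :: "'a::archimedean_vector_lattice"
  assumes "0 \<le> x" and ind: "\<And>b. P b \<Longrightarrow> P (b - x)" and "P y" and nn: "\<And>b. P b \<Longrightarrow> z \<le> b"
  shows "x = 0"
proof (rule archimedean[OF assms(1)])
  fix n
  have "P (y - real n *\<^sub>R x)"
  proof (induction n)
    case (Suc n) then show ?case using ind by (fastforce simp: algebra_simps)
  qed (simp add: assms)
  then have "z \<le> y - real n *\<^sub>R x" by (rule nn)
  then show "real n *\<^sub>R x \<le> y - z" by (simp add: algebra_simps)
qed


section \<open>Solid neighbourhoods of zero\<close>

text \<open>Solidity is built in, while openness is asked only of a subset: such sets form a base at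
  zero in a locally solid topology, and order estimates apply to them directly.\<close>

definition zero_nhd :: "'a::vector_lattice topology \<Rightarrow> 'a set \<Rightarrow> bool" where
  "zero_nhd T V \<longleftrightarrow> solid V \<and> (\<exists>W. openin T W \<and> 0 \<in> W \<and> W \<subseteq> V)"

lemma solidD: "solid V \<Longrightarrow> x \<in> V \<Longrightarrow> \<bar>y\<bar> \<le> \<bar>x\<bar> \<Longrightarrow> y \<in> V"
  unfolding solid_def by blast

lemma solid_nonneg:
  "solid V \<Longrightarrow> x \<in> V \<Longrightarrow> 0 \<le> y \<Longrightarrow> y \<le> x \<Longrightarrow> y \<in> V"
  by (erule solidD) (auto simp: abs_of_nonneg order_trans)

lemma solid_abs_iff: "solid V \<Longrightarrow> \<bar>x\<bar> \<in> V \<longleftrightarrow> x \<in> V"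
  by (auto elim: solidD)

lemma zero_nhd_solid: "zero_nhd T V \<Longrightarrow> solid V"
  by (simp add: zero_nhd_def)

lemma zero_nhd_0: "zero_nhd T V \<Longrightarrow> 0 \<in> V"
  by (auto simp: zero_nhd_def)

lemma zero_nhd_Int:
  assumes "zero_nhd T V" "zero_nhd T V'"
  shows "zero_nhd T (V \<inter> V')"
proof -
  obtain W W' where "openin T W" "0 \<in> W" "W \<subseteq> V" "openin T W'" "0 \<in> W'" "W' \<subseteq> V'"
    using assms unfolding zero_nhd_def by metis
  moreover have "solid (V \<inter> V')" using assms unfolding zero_nhd_def solid_def by blast
  ultimately show ?thesis unfolding zero_nhd_def by (intro conjI exI[of _ "W \<inter> W'"]) auto
qed

context
  fixes T :: "'a::vector_lattice topology"
  assumes T: "locally_solid T"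
begin

lemma locally_solid_topspace: "topspace T = UNIV"
  using T by (auto simp: locally_solid_def linear_topology_def)

lemma zero_nhd_base:
  assumes "openin T W" "0 \<in> W"
  obtains V where "zero_nhd T V" "V \<subseteq> W"
  using T assms unfolding locally_solid_def neighbourhood_base_at_def zero_nhd_def by metis

lemma zero_nhd_UNIV: "zero_nhd T UNIV"
  using openin_topspace[of T] by (auto simp: zero_nhd_def solid_def locally_solid_topspace)

lemma zero_nhd_half:
  assumes "zero_nhd T V"
  obtains V' where "zero_nhd T V'" "\<And>x y. x \<in> V' \<Longrightarrow> y \<in> V' \<Longrightarrow> x + y \<in> V"
proof -
  have add: "continuous_map (prod_topology T T) T (\<lambda>(x, y). x + y)"
    using T by (auto simp: locally_solid_def linear_topology_def)
  obtain W where W: "openin T W" "0 \<in> W" "W \<subseteq> V" using assms by (auto simp: zero_nhd_def)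
  obtain A B where AB: "openin T A" "openin T B" "0 \<in> A" "0 \<in> B"
    "\<And>x y. x \<in> A \<Longrightarrow> y \<in> B \<Longrightarrow> (\<lambda>(x, y). x + y) (x, y) \<in> W"
    using continuous_map_prod_nhds[OF add W(1), of 0 0] W(2) locally_solid_topspace by auto
  obtain V' where "zero_nhd T V'" "V' \<subseteq> A \<inter> B"
    using zero_nhd_base[of "A \<inter> B"] AB by auto
  then show thesis using that[of V'] AB(5) W(3) by (metis IntD1 IntD2 case_prod_conv subsetD)
qed

lemma zero_nhd_absorbs:
  assumes "zero_nhd T V"
  obtains e where "0 < e" "e *\<^sub>R x \<in> V"
proof -
  have scale: "continuous_map (prod_topology euclideanreal T) T (\<lambda>(r, x). r *\<^sub>R x)"
    using T by (auto simp: locally_solid_def linear_topology_def)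
  obtain W where W: "openin T W" "0 \<in> W" "W \<subseteq> V" using assms by (auto simp: zero_nhd_def)
  obtain A B where AB: "openin euclideanreal A" "openin T B" "(0::real) \<in> A" "x \<in> B"
    "\<And>r y. r \<in> A \<Longrightarrow> y \<in> B \<Longrightarrow> (\<lambda>(r, x). r *\<^sub>R x) (r, y) \<in> W"
    using continuous_map_prod_nhds[OF scale W(1), of 0 x] W(2) locally_solid_topspace by auto
  then obtain e where e: "0 < e" "ball 0 e \<subseteq> A" by (metis openE open_openin)
  \<comment> \<open>The ball is open and may miss \<open>e\<close> itself.\<close>
  then have "e / 2 \<in> A" by (auto simp: subset_iff dist_real_def)
  then show thesis using that[of "e / 2"] e AB W by fastforce
qed

lemma openin_translate:
  assumes "openin T W"
  shows "openin T {y. y - x \<in> W}"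
proof -
  have "continuous_map (prod_topology T T) T (\<lambda>(x, y). x + y)"
    using T by (auto simp: locally_solid_def linear_topology_def)
  moreover have "continuous_map T (prod_topology T T) (\<lambda>y. (y, - x))"
    by (simp add: continuous_map_pairwise o_def locally_solid_topspace)
  ultimately have "continuous_map T T ((\<lambda>(x, y). x + y) \<circ> (\<lambda>y. (y, - x)))"
    by (rule continuous_map_compose[rotated])
  from openin_continuous_map_preimage[OF this assms] show ?thesis
    by (simp add: locally_solid_topspace)
qed

text \<open>Translations are homeomorphisms, so a locally solid topology is determined by its solid
  neighbourhoods of zero.\<close>

lemma openin_iff_zero_nhd:
  "openin T U \<longleftrightarrow> (\<forall>x\<in>U. \<exists>V. zero_nhd T V \<and> (\<forall>y. y - x \<in> V \<longrightarrow> y \<in> U))"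
proof
  assume U: "openin T U"
  show "\<forall>x\<in>U. \<exists>V. zero_nhd T V \<and> (\<forall>y. y - x \<in> V \<longrightarrow> y \<in> U)"
  proof
    fix x assume "x \<in> U"
    then obtain V where V: "zero_nhd T V" "V \<subseteq> {y. y - (- x) \<in> U}"
      using zero_nhd_base[OF openin_translate[OF U, of "- x"]] by auto
    have "y \<in> U" if "y - x \<in> V" for y using V that by auto
    then show "\<exists>V. zero_nhd T V \<and> (\<forall>y. y - x \<in> V \<longrightarrow> y \<in> U)" using V by blast
  qed
next
  assume *: "\<forall>x\<in>U. \<exists>V. zero_nhd T V \<and> (\<forall>y. y - x \<in> V \<longrightarrow> y \<in> U)"
  show "openin T U"
  proof (subst openin_subopen, rule ballI)
    fix x assume "x \<in> U"
    then obtain V where V: "zero_nhd T V" "\<forall>y. y - x \<in> V \<longrightarrow> y \<in> U" using * by blast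
    then obtain W where W: "openin T W" "0 \<in> W" "W \<subseteq> V" by (auto simp: zero_nhd_def)
    show "\<exists>W. openin T W \<and> x \<in> W \<and> W \<subseteq> U"
      using openin_translate[OF W(1), of x] V W by (intro exI[of _ "{y. y - x \<in> W}"]) auto
  qed
qed

lemma limitin_iff_zero_nhd:
  "limitin T x l F \<longleftrightarrow> (\<forall>V. zero_nhd T V \<longrightarrow> eventually (\<lambda>a. x a - l \<in> V) F)"
proof
  assume lim: "limitin T x l F"
  show "\<forall>V. zero_nhd T V \<longrightarrow> eventually (\<lambda>a. x a - l \<in> V) F"
  proof (intro allI impI)
    fix V assume "zero_nhd T V"
    then obtain W where W: "openin T W" "0 \<in> W" "W \<subseteq> V" by (auto simp: zero_nhd_def)
    have "eventually (\<lambda>a. x a \<in> {y. y - l \<in> W}) F"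
      using lim openin_translate[OF W(1), of l] W(2) by (auto simp: limitin_def)
    then show "eventually (\<lambda>a. x a - l \<in> V) F"
      by (rule eventually_mono) (use W in auto)
  qed
next
  assume *: "\<forall>V. zero_nhd T V \<longrightarrow> eventually (\<lambda>a. x a - l \<in> V) F"
  show "limitin T x l F"
    unfolding limitin_def
  proof (intro conjI allI impI)
    fix U assume "openin T U \<and> l \<in> U"
    then obtain V where V: "zero_nhd T V" "\<forall>y. y - l \<in> V \<longrightarrow> y \<in> U"
      using openin_iff_zero_nhd[of U] by auto
    then have "eventually (\<lambda>a. x a - l \<in> V) F" using * by blast
    then show "eventually (\<lambda>a. x a \<in> U) F" by (rule eventually_mono) (use V in auto)
  qed (simp add: locally_solid_topspace)
qed

text \<open>For the converse, halve a neighbourhood that misses \<open>x - y\<close>. Solid sets are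
  symmetric, so a common point \<open>z\<close> of the two translates of the half would put
  \<open>(x - z) + (z - y)\<close> into that neighbourhood.\<close>

lemma Hausdorff_iff_zero_nhd:
  "Hausdorff_space T \<longleftrightarrow> (\<forall>x. (\<forall>V. zero_nhd T V \<longrightarrow> x \<in> V) \<longrightarrow> x = 0)"
proof
  assume H: "Hausdorff_space T"
  show "\<forall>x. (\<forall>V. zero_nhd T V \<longrightarrow> x \<in> V) \<longrightarrow> x = 0"
  proof (intro allI impI, rule ccontr)
    fix x assume x: "\<forall>V. zero_nhd T V \<longrightarrow> x \<in> V" "x \<noteq> 0"
    then obtain A B where "openin T A" "openin T B" "0 \<in> A" "x \<in> B" "disjnt A B"
      using H unfolding Hausdorff_space_def locally_solid_topspace by (metis UNIV_I)
    moreover from this obtain V where "zero_nhd T V" "V \<subseteq> A" using zero_nhd_base by metis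
    ultimately show False using x by (auto simp: disjnt_iff)
  qed
next
  assume *: "\<forall>x. (\<forall>V. zero_nhd T V \<longrightarrow> x \<in> V) \<longrightarrow> x = 0"
  show "Hausdorff_space T"
    unfolding Hausdorff_space_def locally_solid_topspace
  proof (intro allI impI)
    fix x y :: 'a assume "x \<in> UNIV \<and> y \<in> UNIV \<and> x \<noteq> y"
    then have "x - y \<noteq> 0" by simp
    then obtain V where V: "zero_nhd T V" "x - y \<notin> V" using * by blast
    obtain V' where V': "zero_nhd T V'" "\<And>x y. x \<in> V' \<Longrightarrow> y \<in> V' \<Longrightarrow> x + y \<in> V"
      using zero_nhd_half[OF V(1)] by metis
    obtain W where W: "openin T W" "0 \<in> W" "W \<subseteq> V'" using V' by (auto simp: zero_nhd_def)
    have "z - x \<notin> W \<or> z - y \<notin> W" for z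
    proof (rule ccontr)
      assume "\<not> (z - x \<notin> W \<or> z - y \<notin> W)"
      then have z: "z - x \<in> V'" "z - y \<in> V'" using W by auto
      have "x - z \<in> V'"
        using solidD[OF zero_nhd_solid[OF V'(1)] z(1), of "x - z"] by (simp add: abs_minus_commute)
      then have "(x - z) + (z - y) \<in> V" using V'(2) z by blast
      then show False using V by simp
    qed
    then show "\<exists>U V. openin T U \<and> openin T V \<and> x \<in> U \<and> y \<in> V \<and> disjnt U V"
      using openin_translate[OF W(1), of x] openin_translate[OF W(1), of y] W(2)
      by (intro exI[of _ "{z. z - x \<in> W}"] exI[of _ "{z. z - y \<in> W}"]) (auto simp: disjnt_iff)
  qed
qed

end

section \<open>Constructing locally solid topologies\<close>

text \<open>The classical construction of a linear topology from a filter base at zero. Solidity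
  does the work of balancedness: together with absorption and repeated halving it makes scalar
  multiplication jointly continuous.\<close>

lemma ex_locally_solid_topology:
  fixes \<B> :: "'a::vector_lattice set set"
  assumes ne: "\<B> \<noteq> {}"
    and solid: "\<And>B. B \<in> \<B> \<Longrightarrow> solid B"
    and Int: "\<And>B B'. B \<in> \<B> \<Longrightarrow> B' \<in> \<B> \<Longrightarrow> \<exists>C\<in>\<B>. C \<subseteq> B \<inter> B'"
    and half: "\<And>B. B \<in> \<B> \<Longrightarrow> \<exists>C\<in>\<B>. \<forall>x\<in>C. \<forall>y\<in>C. x + y \<in> B"
    and absorb: "\<And>B x. B \<in> \<B> \<Longrightarrow> \<exists>e>0. e *\<^sub>R x \<in> B"
  obtains S where "locally_solid S" "\<And>V. zero_nhd S V \<longleftrightarrow> solid V \<and> (\<exists>B\<in>\<B>. B \<subseteq> V)"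
proof -
  have B_solid: "y \<in> B" if "B \<in> \<B>" "x \<in> B" "\<bar>y\<bar> \<le> \<bar>x\<bar>" for B x y
    using solidD[OF solid] that by blast
  have B_0: "0 \<in> B" if "B \<in> \<B>" for B
    using absorb[OF that, of 0] by auto
  \<comment> \<open>Halving \<open>n\<close> times controls multiplication by \<open>2 ^ n\<close>,
    and powers of two dominate every scalar.\<close>
  have B_mult: "\<exists>C\<in>\<B>. \<forall>x\<in>C. (2 ^ n) *\<^sub>R x \<in> B" if "B \<in> \<B>" for B and n :: nat
    using that
  proof (induction n arbitrary: B)
    case 0 then show ?case by auto
  next
    case (Suc n)
    obtain C where C: "C \<in> \<B>" "\<forall>x\<in>C. \<forall>y\<in>C. x + y \<in> B" using half[OF Suc.prems] by blast
    obtain C' where C': "C' \<in> \<B>" "\<forall>x\<in>C'. (2 ^ n) *\<^sub>R x \<in> C" using Suc.IH[OF C(1)] by blast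
    have "(2 ^ Suc n) *\<^sub>R x \<in> B" if "x \<in> C'" for x
    proof -
      have "(2 ^ n) *\<^sub>R x + (2 ^ n) *\<^sub>R x \<in> B" using C C' that by blast
      then show ?thesis by (simp flip: scaleR_left.add)
    qed
    then show ?case using C' by blast
  qed

  define op where "op U \<longleftrightarrow> (\<forall>x\<in>U. \<exists>B\<in>\<B>. \<forall>y. y - x \<in> B \<longrightarrow> y \<in> U)" for U
  have istop: "istopology op"
    unfolding istopology_def
  proof (intro conjI allI impI)
    fix U U' assume U: "op U" "op U'"
    show "op (U \<inter> U')"
      unfolding op_def
    proof
      fix x assume "x \<in> U \<inter> U'"
      then obtain B B' where "B \<in> \<B>" "\<forall>y. y - x \<in> B \<longrightarrow> y \<in> U"
        "B' \<in> \<B>" "\<forall>y. y - x \<in> B' \<longrightarrow> y \<in> U'"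
        using U unfolding op_def by (metis IntD1 IntD2)
      then show "\<exists>B\<in>\<B>. \<forall>y. y - x \<in> B \<longrightarrow> y \<in> U \<inter> U'"
        using Int[of B B'] by blast
    qed
  next
    fix K assume "\<forall>U\<in>K. op U"
    then show "op (\<Union>K)" unfolding op_def by (meson Union_iff)
  qed
  define S where "S = topology op"
  have S: "openin S U \<longleftrightarrow> op U" for U by (simp add: S_def topology_inverse' istop)
  have opD: "\<exists>B\<in>\<B>. \<forall>y. y - x \<in> B \<longrightarrow> y \<in> U" if "openin S U" "x \<in> U" for U x
    using that(1)[unfolded S op_def] that(2) by (rule bspec)
  have topS[simp]: "topspace S = UNIV"
  proof -
    have "op UNIV" using ne unfolding op_def by blast
    then show ?thesis using openin_subset[of S UNIV] S by auto
  qed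
  have op_inner: "\<exists>U. openin S U \<and> x \<in> U \<and> (\<forall>y\<in>U. y - x \<in> B)" if "B \<in> \<B>" for B x
  proof -
    \<comment> \<open>The translate of \<open>B\<close> to \<open>x\<close> need not be open.
      \<open>U\<close> is its interior, and halving shows that \<open>U\<close> is open.\<close>
    define U where "U = {z. \<exists>C\<in>\<B>. \<forall>y. y - z \<in> C \<longrightarrow> y - x \<in> B}"
    have "op U"
      unfolding op_def
    proof
      fix z assume "z \<in> U"
      then obtain C where C: "C \<in> \<B>" "\<forall>y. y - z \<in> C \<longrightarrow> y - x \<in> B" by (auto simp: U_def)
      obtain C' where C': "C' \<in> \<B>" "\<forall>x\<in>C'. \<forall>y\<in>C'. x + y \<in> C" using half[OF C(1)] by blast
      have "w \<in> U" if w: "w - z \<in> C'" for w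
      proof -
        have "y - x \<in> B" if "y - w \<in> C'" for y
        proof -
          have "(y - w) + (w - z) \<in> C" using C' w that by blast
          then show ?thesis using C by simp
        qed
        then show ?thesis using C' unfolding U_def by blast
      qed
      then show "\<exists>B\<in>\<B>. \<forall>y. y - z \<in> B \<longrightarrow> y \<in> U" using C' by blast
    qed
    moreover have "x \<in> U" using that by (auto simp: U_def)
    moreover have "y - x \<in> B" if "y \<in> U" for y
    proof -
      obtain C where "C \<in> \<B>" "\<forall>w. w - y \<in> C \<longrightarrow> w - x \<in> B" using \<open>y \<in> U\<close> by (auto simp: U_def)
      then show ?thesis using B_0[of C] by (metis diff_self)
    qed
    ultimately show ?thesis using S by blast
  qed

  have addS: "continuous_map (prod_topology S S) S (\<lambda>(x, y). x + y)"
    unfolding continuous_map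
  proof (intro conjI allI impI)
    fix U assume U: "openin S U"
    show "openin (prod_topology S S) {p \<in> topspace (prod_topology S S). (\<lambda>(x, y). x + y) p \<in> U}"
      unfolding openin_prod_topology_alt
    proof (intro allI impI)
      fix a b assume "(a, b) \<in> {p \<in> topspace (prod_topology S S). (\<lambda>(x, y). x + y) p \<in> U}"
      then have "a + b \<in> U" by auto
      then obtain B where B: "B \<in> \<B>" "\<forall>y. y - (a + b) \<in> B \<longrightarrow> y \<in> U" using opD[OF U] by meson
      obtain C where C: "C \<in> \<B>" "\<forall>x\<in>C. \<forall>y\<in>C. x + y \<in> B" using half[OF B(1)] by blast
      obtain V where V: "openin S V" "a \<in> V" "\<forall>y\<in>V. y - a \<in> C" using op_inner C by meson
      obtain W where W: "openin S W" "b \<in> W" "\<forall>y\<in>W. y - b \<in> C" using op_inner C by meson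
      have "x + y \<in> U" if "x \<in> V" "y \<in> W" for x y
      proof -
        have "(x - a) + (y - b) \<in> B" using V W C that by blast
        then show ?thesis using B by (simp add: algebra_simps)
      qed
      then show "\<exists>A B. openin S A \<and> openin S B \<and> a \<in> A \<and> b \<in> B \<and>
          A \<times> B \<subseteq> {p \<in> topspace (prod_topology S S). (\<lambda>(x, y). x + y) p \<in> U}"
        using V W by (intro exI[of _ V] exI[of _ W]) auto
    qed
  qed auto

  have scaleS: "continuous_map (prod_topology euclideanreal S) S (\<lambda>(r, x). r *\<^sub>R x)"
    unfolding continuous_map
  proof (intro conjI allI impI)
    fix U assume U: "openin S U"
    let ?P = "{p \<in> topspace (prod_topology euclideanreal S). (\<lambda>(r, x). r *\<^sub>R x) p \<in> U}"
    show "openin (prod_topology euclideanreal S) ?P"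
      unfolding openin_prod_topology_alt
    proof (intro allI impI)
      fix r x assume "(r, x) \<in> ?P"
      then have "r *\<^sub>R x \<in> U" by auto
      then obtain B where B: "B \<in> \<B>" "\<forall>y. y - r *\<^sub>R x \<in> B \<longrightarrow> y \<in> U" using opD[OF U] by meson
      obtain C where C: "C \<in> \<B>" "\<forall>x\<in>C. \<forall>y\<in>C. x + y \<in> B" using half[OF B(1)] by blast
      obtain e where e: "0 < e" "e *\<^sub>R \<bar>x\<bar> \<in> C" using absorb[OF C(1)] by blast
      obtain n :: nat where n: "\<bar>r\<bar> + 1 < 2 ^ n" using real_arch_pow[of 2] by auto
      obtain C' where C': "C' \<in> \<B>" "\<forall>x\<in>C'. (2 ^ n) *\<^sub>R x \<in> C" using B_mult[OF C(1)] by blast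
      obtain V where V: "openin S V" "x \<in> V" "\<forall>y\<in>V. y - x \<in> C'" using op_inner C' by meson
      \<comment> \<open>In \<open>s y - r x = s (y - x) + (s - r) x\<close> the radius bound
        \<open>e\<close> keeps the last term in \<open>C\<close>, and the bound 1 keeps the absolute
        value of \<open>s\<close> below \<open>2 ^ n\<close>.\<close>
      define I where "I = ball r (min e 1)"
      have "s *\<^sub>R y \<in> U" if s: "s \<in> I" and y: "y \<in> V" for s y
      proof -
        have sr: "\<bar>s - r\<bar> \<le> e" "\<bar>s\<bar> \<le> 2 ^ n"
          using s n by (auto simp: I_def dist_real_def)
        have "abs ((s - r) *\<^sub>R x) \<le> e *\<^sub>R \<bar>x\<bar>" using abs_scaleR_le[OF sr(1)] .
        then have 1: "(s - r) *\<^sub>R x \<in> C"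
          using B_solid[OF C(1) e(2)] abs_ge_self order_trans by blast
        have "abs (2 ^ n *\<^sub>R (y - x)) \<in> C"
          using C' V y solid_abs_iff[OF solid[OF C(1)]] by blast
        \<comment> \<open>\<open>abs_scaleR_le\<close> bounds only the absolute value of a multiple
          from above; used with the inverse scalar it gives the opposite estimate.\<close>
        moreover have "2 ^ n *\<^sub>R \<bar>y - x\<bar> \<le> \<bar>2 ^ n *\<^sub>R (y - x)\<bar>"
        proof -
          have "\<bar>(1 / 2 ^ n) *\<^sub>R (2 ^ n *\<^sub>R (y - x))\<bar> \<le> (1 / 2 ^ n) *\<^sub>R \<bar>2 ^ n *\<^sub>R (y - x)\<bar>"
            by (rule abs_scaleR_le) simp
          from scaleR_left_mono[OF this, of "2 ^ n"] show ?thesis by simp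
        qed
        then have "\<bar>s *\<^sub>R (y - x)\<bar> \<le> \<bar>2 ^ n *\<^sub>R (y - x)\<bar>"
          using abs_scaleR_le[OF sr(2), of "y - x"] by (rule order_trans[rotated])
        ultimately have 2: "s *\<^sub>R (y - x) \<in> C" using B_solid[OF C(1)] by simp
        have "s *\<^sub>R (y - x) + (s - r) *\<^sub>R x \<in> B" using 1 2 C by blast
        then show ?thesis using B by (simp add: algebra_simps)
      qed
      moreover have "openin euclideanreal I" "r \<in> I" using e by (auto simp: I_def)
      ultimately show "\<exists>A B. openin euclideanreal A \<and> openin S B \<and> r \<in> A \<and> x \<in> B \<and> A \<times> B \<subseteq> ?P"
        using V by (intro exI[of _ I] exI[of _ V]) auto
    qed
  qed auto

  have nhd: "\<exists>U. openin S U \<and> 0 \<in> U \<and> U \<subseteq> B" if "B \<in> \<B>" for B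
    using op_inner[OF that, of 0] by auto
  have "neighbourhood_base_at 0 solid S"
    unfolding neighbourhood_base_at_def
  proof (intro allI impI)
    fix W assume "openin S W \<and> 0 \<in> W"
    then obtain B where "B \<in> \<B>" "B \<subseteq> W" using opD[of W 0] by auto
    then show "\<exists>U V. openin S U \<and> solid V \<and> 0 \<in> U \<and> U \<subseteq> V \<and> V \<subseteq> W"
      using nhd[of B] solid[of B] by blast
  qed
  then have "locally_solid S"
    using addS scaleS by (simp add: locally_solid_def linear_topology_def)
  moreover have "zero_nhd S V \<longleftrightarrow> solid V \<and> (\<exists>B\<in>\<B>. B \<subseteq> V)" for V
  proof
    assume "zero_nhd S V"
    then obtain W where W: "solid V" "openin S W" "0 \<in> W" "W \<subseteq> V" by (auto simp: zero_nhd_def)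
    then show "solid V \<and> (\<exists>B\<in>\<B>. B \<subseteq> V)" using opD[of W 0] by auto
  next
    assume "solid V \<and> (\<exists>B\<in>\<B>. B \<subseteq> V)"
    then obtain B where B: "solid V" "B \<in> \<B>" "B \<subseteq> V" by blast
    obtain U where "openin S U" "0 \<in> U" "U \<subseteq> B" using nhd[OF B(2)] by blast
    then show "zero_nhd S V" using B unfolding zero_nhd_def by (meson order_trans)
  qed
  ultimately show thesis by (rule that)
qed

text \<open>
  If \<open>T\<close> is Hausdorff, \<open>S\<close> stays Hausdorff as long as no nonzero element is disjoint from \<open>G\<close>, so
  \<open>G\<close> may be much smaller than the positive cone.
\<close>

lemma ex_unbounded_topology_wrt:
  fixes T :: "'a::vector_lattice topology"
  assumes T: "locally_solid T" and G0: "0 \<in> G" and G: "\<And>a. a \<in> G \<Longrightarrow> 0 \<le> a"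
    and add: "\<And>a b. a \<in> G \<Longrightarrow> b \<in> G \<Longrightarrow> a + b \<in> G"
  obtains S where "locally_solid S"
    "\<And>W a. zero_nhd T W \<Longrightarrow> a \<in> G \<Longrightarrow> zero_nhd S {x. inf \<bar>x\<bar> a \<in> W}"
    "\<And>V. zero_nhd S V \<Longrightarrow> \<exists>W a. zero_nhd T W \<and> a \<in> G \<and> {x. inf \<bar>x\<bar> a \<in> W} \<subseteq> V"
proof -
  define N where "N W a = {x. inf \<bar>x\<bar> a \<in> W}" for W and a :: 'a
  define \<B> where "\<B> = {N W a |W a. zero_nhd T W \<and> a \<in> G}"
  have BI: "N W a \<in> \<B>" if "zero_nhd T W" "a \<in> G" for W a
    using that by (auto simp: \<B>_def)
  have BE: thesis if "B \<in> \<B>" "\<And>W a. zero_nhd T W \<Longrightarrow> a \<in> G \<Longrightarrow> B = N W a \<Longrightarrow> thesis" for B thesis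
    using that by (auto simp: \<B>_def)
  have mem: "inf \<bar>x\<bar> a \<in> W" if "zero_nhd T W" "y \<in> W" "0 \<le> a" "inf \<bar>x\<bar> a \<le> y" for x y a W
    using solid_nonneg[OF zero_nhd_solid[OF that(1)] that(2) _ that(4)] that(3) by simp
  have N_solid: "solid (N W a)" if "zero_nhd T W" "a \<in> G" for W a
    unfolding solid_def N_def
    using mem[OF that(1) _ G[OF that(2)]] inf_mono[OF _ order_refl] by blast
  obtain S where S: "locally_solid S" "\<And>V. zero_nhd S V \<longleftrightarrow> solid V \<and> (\<exists>B\<in>\<B>. B \<subseteq> V)"
  proof (rule ex_locally_solid_topology)
    show "\<B> \<noteq> {}" using BI[OF zero_nhd_UNIV[OF T] G0] by blast
  next
    fix B assume "B \<in> \<B>"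
    then obtain W a where W: "zero_nhd T W" "a \<in> G" "B = N W a" by (rule BE)
    show "solid B" unfolding W(3) using W(1,2) by (rule N_solid)
    show "\<exists>C\<in>\<B>. \<forall>x\<in>C. \<forall>y\<in>C. x + y \<in> B"
    proof -
      obtain W' where W': "zero_nhd T W'" "\<And>x y. x \<in> W' \<Longrightarrow> y \<in> W' \<Longrightarrow> x + y \<in> W"
        using zero_nhd_half[OF T W(1)] by metis
      have "x + y \<in> B" if "x \<in> N W' a" "y \<in> N W' a" for x y
        using that mem[OF W(1) W'(2) G[OF W(2)] inf_abs_add_le[OF G[OF W(2)]]]
        unfolding W N_def by blast
      then show ?thesis using BI[OF W'(1) W(2)] by blast
    qed
    fix x
    obtain e where "0 < e" "e *\<^sub>R x \<in> W" using zero_nhd_absorbs[OF T W(1)] by metis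
    then show "\<exists>e>0. e *\<^sub>R x \<in> B"
      unfolding W N_def
      using mem[OF W(1) _ G[OF W(2)] inf_le1] solid_abs_iff[OF zero_nhd_solid[OF W(1)]] by blast
  next
    fix B B' assume "B \<in> \<B>" "B' \<in> \<B>"
    then obtain W a W' a' where W: "zero_nhd T W" "a \<in> G" "B = N W a"
      "zero_nhd T W'" "a' \<in> G" "B' = N W' a'" by (metis BE)
    \<comment> \<open>The sum is an upper bound of \<open>a\<close> and \<open>a'\<close> that is
      known to lie in \<open>G\<close>.\<close>
    have "N (W \<inter> W') (a + a') \<subseteq> B \<inter> B'"
    proof
      fix x assume "x \<in> N (W \<inter> W') (a + a')"
      then have x: "inf \<bar>x\<bar> (a + a') \<in> W" "inf \<bar>x\<bar> (a + a') \<in> W'" by (auto simp: N_def)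
      have "inf \<bar>x\<bar> a \<le> inf \<bar>x\<bar> (a + a')" "inf \<bar>x\<bar> a' \<le> inf \<bar>x\<bar> (a + a')"
        using G[OF W(2)] G[OF W(5)] by (simp_all add: le_infI2)
      then show "x \<in> B \<inter> B'"
        unfolding W N_def using mem[OF W(1) x(1) G[OF W(2)]] mem[OF W(4) x(2) G[OF W(5)]] by blast
    qed
    then show "\<exists>C\<in>\<B>. C \<subseteq> B \<inter> B'"
      using BI[OF zero_nhd_Int[OF W(1,4)] add[OF W(2,5)]] by blast
  next
    fix S assume "locally_solid S" "\<And>V. zero_nhd S V \<longleftrightarrow> solid V \<and> (\<exists>B\<in>\<B>. B \<subseteq> V)"
    then show thesis by (rule that)
  qed
  show thesis
  proof (rule that[OF S(1), folded N_def])
    fix W a assume W: "zero_nhd T W" "a \<in> G"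
    then show "zero_nhd S (N W a)" using S(2) N_solid[OF W] BI[OF W] by blast
  next
    fix V assume "zero_nhd S V"
    then show "\<exists>W a. zero_nhd T W \<and> a \<in> G \<and> N W a \<subseteq> V" using S(2)[of V] by (metis BE)
  qed
qed

lemma openin_mono_iff_zero_nhd:
  assumes "locally_solid S" "locally_solid T"
  shows "(\<forall>U. openin S U \<longrightarrow> openin T U) \<longleftrightarrow> (\<forall>V. zero_nhd S V \<longrightarrow> zero_nhd T V)"
proof
  assume "\<forall>U. openin S U \<longrightarrow> openin T U"
  then show "\<forall>V. zero_nhd S V \<longrightarrow> zero_nhd T V" unfolding zero_nhd_def by blast
next
  assume "\<forall>V. zero_nhd S V \<longrightarrow> zero_nhd T V"
  then show "\<forall>U. openin S U \<longrightarrow> openin T U"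
    unfolding openin_iff_zero_nhd[OF assms(1)] openin_iff_zero_nhd[OF assms(2)] by blast
qed


section \<open>Lebesgue topologies\<close>

lemma order_converges_decreases_to_zero:
  assumes "directed_set E le" "decreases_to_zero E le y"
  shows "order_converges E le y 0"
  using assms unfolding decreases_to_zero_def
  by (intro order_convergesI[OF assms]) (auto simp: abs_of_nonneg)

text \<open>Indexed by itself under the reversed order, \<open>Z\<close> is a net that decreases to
  zero.\<close>

lemma Lebesgue_downward_directed:
  fixes Z :: "'a::vector_lattice set"
  assumes T: "locally_solid T" "Lebesgue T" and V: "zero_nhd T V"
    and Z: "Z \<noteq> {}" "\<And>a b. a \<in> Z \<Longrightarrow> b \<in> Z \<Longrightarrow> \<exists>c\<in>Z. c \<le> a \<and> c \<le> b"
      "\<And>a. a \<in> Z \<Longrightarrow> 0 \<le> a" "\<And>z. (\<And>a. a \<in> Z \<Longrightarrow> z \<le> a) \<Longrightarrow> z \<le> 0"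
  obtains z where "z \<in> Z" "z \<in> V"
proof -
  have D: "directed_set Z (\<lambda>a b. b \<le> a)"
    using Z unfolding directed_set_def by (meson order_refl order_trans)
  have "decreases_to_zero Z (\<lambda>a b. b \<le> a) (\<lambda>z. z)"
    unfolding decreases_to_zero_def
  proof (intro conjI allI impI)
    fix z assume "\<forall>a\<in>Z. z \<le> a"
    then show "z \<le> 0" by (intro Z(4)) blast
  qed (auto simp: Z(3))
  then have "limitin T (\<lambda>z. z) 0 (net_filter Z (\<lambda>a b. b \<le> a))"
    by (intro LebesgueD[OF T(2) D] order_converges_decreases_to_zero[OF D])
  then have "eventually (\<lambda>z. z \<in> V) (net_filter Z (\<lambda>a b. b \<le> a))"
    using V by (simp add: limitin_iff_zero_nhd[OF T(1)])
  then show thesis using that by (auto simp: eventually_net_filter[OF D])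
qed

text \<open>A substitute for suprema, which need not exist. The differences between upper bounds and
  members of \<open>F\<close> decrease to zero: a positive lower bound of them could be subtracted
  from every upper bound and leave an upper bound, against the Archimedean property.\<close>

lemma Lebesgue_upper_bound:
  fixes F :: "'a::archimedean_vector_lattice set"
  assumes T: "locally_solid T" "Lebesgue T" and V: "zero_nhd T V"
    and F: "F \<noteq> {}" "\<And>a b. a \<in> F \<Longrightarrow> b \<in> F \<Longrightarrow> \<exists>c\<in>F. a \<le> c \<and> b \<le> c"
    and w: "\<And>a. a \<in> F \<Longrightarrow> a \<le> w"
  obtains b s where "s \<in> F" "\<And>a. a \<in> F \<Longrightarrow> a \<le> b" "b - s \<in> V"
proof -
  define B where "B = {b. \<forall>a\<in>F. a \<le> b}"
  define Z where "Z = {b - s |b s. b \<in> B \<and> s \<in> F}"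
  have ZI: "b - s \<in> Z" if "b \<in> B" "s \<in> F" for b s using that by (auto simp: Z_def)
  have w: "w \<in> B" using w by (auto simp: B_def)
  obtain s0 where s0: "s0 \<in> F" using F(1) by blast
  obtain z where "z \<in> Z" "z \<in> V"
  proof (rule Lebesgue_downward_directed[OF T V])
    show "Z \<noteq> {}" using ZI[OF w s0] by blast
  next
    fix x y assume "x \<in> Z" "y \<in> Z"
    then obtain b b' s s' where bs: "x = b - s" "y = b' - s'" "b \<in> B" "b' \<in> B" "s \<in> F" "s' \<in> F"
      by (auto simp: Z_def)
    obtain t where t: "t \<in> F" "s \<le> t" "s' \<le> t" using F(2) bs by meson
    have "inf b b' \<in> B" using bs by (auto simp: B_def)
    then have "inf b b' - t \<in> Z" using t by (intro ZI)
    moreover have "inf b b' - t \<le> x" "inf b b' - t \<le> y"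
      unfolding bs using t by (auto intro!: diff_mono)
    ultimately show "\<exists>c\<in>Z. c \<le> x \<and> c \<le> y" by blast
  next
    fix x assume "x \<in> Z" then show "0 \<le> x" by (auto simp: Z_def B_def)
  next
    fix z assume z: "\<And>x. x \<in> Z \<Longrightarrow> z \<le> x"
    \<comment> \<open>The differences are positive, so the positive part of a lower bound is again a
      lower bound.\<close>
    have "sup z 0 = 0"
    proof (rule multiples_bounded_imp_zero[where P = "\<lambda>b. b \<in> B"])
      fix b assume b: "b \<in> B"
      have "a \<le> b - sup z 0" if "a \<in> F" for a
      proof -
        have "sup z 0 \<le> b - a" using z[OF ZI[OF b that]] b that by (auto simp: B_def)
        then show ?thesis by (simp only: le_diff_eq add.commute)
      qed
      then show "b - sup z 0 \<in> B" by (auto simp: B_def)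
    qed (use w s0 in \<open>auto simp: B_def\<close>)
    then show "z \<le> 0" by (metis sup_ge1)
  qed
  then show thesis using that by (auto simp: Z_def B_def)
qed

text \<open>\<open>I\<close> is the positive cone of an order dense ideal, and the differences
  \<open>u - a\<close> decrease to zero. Indeed, if \<open>z\<close> lies below all of them, then
  the infimum of its positive part with a member of \<open>I\<close> can be added to any such
  \<open>a\<close> without leaving \<open>I\<close> or exceeding \<open>u\<close>. Repetition makes
  this infimum zero, and density makes the positive part of \<open>z\<close> zero.\<close>

lemma Lebesgue_approx:
  fixes I :: "'a::archimedean_vector_lattice set"
  assumes T: "locally_solid T" "Lebesgue T" and V: "zero_nhd T V" and u: "0 \<le> u"
    and I: "0 \<in> I" "\<And>a. a \<in> I \<Longrightarrow> 0 \<le> a" "\<And>a b. a \<in> I \<Longrightarrow> b \<in> I \<Longrightarrow> a + b \<in> I"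
      "\<And>a b. a \<in> I \<Longrightarrow> 0 \<le> b \<Longrightarrow> b \<le> a \<Longrightarrow> b \<in> I"
    and dense: "\<And>z. 0 \<le> z \<Longrightarrow> (\<And>a. a \<in> I \<Longrightarrow> inf z a = 0) \<Longrightarrow> z = 0"
  obtains a where "a \<in> I" "a \<le> u" "u - a \<in> V"
proof -
  define Z where "Z = {u - a |a. a \<in> I \<and> a \<le> u}"
  obtain z where "z \<in> Z" "z \<in> V"
  proof (rule Lebesgue_downward_directed[OF T V])
    show "Z \<noteq> {}" using I(1) u by (auto simp: Z_def)
  next
    fix x y assume "x \<in> Z" "y \<in> Z"
    then obtain a b where ab: "x = u - a" "y = u - b" "a \<in> I" "b \<in> I" "a \<le> u" "b \<le> u"
      by (auto simp: Z_def)
    have "sup a b \<in> I"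
    proof (rule I(4)[OF I(3)[OF ab(3,4)]])
      show "0 \<le> sup a b" using I(2)[OF ab(3)] by (rule le_supI1)
      show "sup a b \<le> a + b" using I(2)[OF ab(3)] I(2)[OF ab(4)] by simp
    qed
    moreover have "sup a b \<le> u" using ab(5,6) by (rule le_supI)
    ultimately have "u - sup a b \<in> Z" unfolding Z_def by blast
    moreover have "u - sup a b \<le> x" "u - sup a b \<le> y" unfolding ab by (auto intro!: diff_mono)
    ultimately show "\<exists>c\<in>Z. c \<le> x \<and> c \<le> y" by blast
  next
    fix x assume "x \<in> Z" then show "0 \<le> x" by (auto simp: Z_def)
  next
    fix z assume z: "\<And>x. x \<in> Z \<Longrightarrow> z \<le> x"
    have le: "z \<le> u - a" if "a \<in> I" "a \<le> u" for a using z that by (auto simp: Z_def)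
    have "sup z 0 = 0"
    proof (rule dense)
      fix i assume i: "i \<in> I"
      define r where "r = inf (sup z 0) i"
      have r: "0 \<le> r" "r \<in> I" "r \<le> sup z 0"
        using I(4)[OF i, of r] I(2)[OF i] by (auto simp: r_def)
      show "inf (sup z 0) i = 0"
        unfolding r_def[symmetric]
      proof (rule multiples_bounded_imp_zero[where P = "\<lambda>b. u - b \<in> I \<and> 0 \<le> b" and y = u and z = 0])
        fix b assume b: "u - b \<in> I \<and> 0 \<le> b"
        then have "sup z 0 \<le> b" using le[of "u - b"] by simp
        then have "r \<le> b" using r(3) by (rule order_trans[rotated])
        moreover have "u - (b - r) \<in> I" using I(3)[of "u - b" r] b r by (simp add: algebra_simps)
        ultimately show "u - (b - r) \<in> I \<and> 0 \<le> b - r" by simp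
      qed (use r(1) I(1) u in simp_all)
    qed simp
    then show "z \<le> 0" by (metis sup_ge1)
  qed
  then show thesis using that by (auto simp: Z_def)
qed


section \<open>Normal sequences of neighbourhoods and their carriers\<close>

text \<open>For locally solid \<open>T\<close>, such a sequence is a countable base at zero of a
  coarser locally solid topology, which may fail to be Hausdorff.\<close>

definition normal_seq :: "'a::vector_lattice topology \<Rightarrow> (nat \<Rightarrow> 'a set) \<Rightarrow> bool" where
  "normal_seq T A \<longleftrightarrow> (\<forall>n. zero_nhd T (A n)) \<and> (\<forall>n. \<forall>x\<in>A (Suc n). \<forall>y\<in>A (Suc n). x + y \<in> A n)"

text \<open>For a normal sequence the intersection is an ideal, the null ideal, and this is the
  positive cone of its disjoint complement. There the sequence separates points: an element lying in
  every \<open>A n\<close> is disjoint from itself.\<close>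

definition carrier :: "(nat \<Rightarrow> 'a::vector_lattice set) \<Rightarrow> 'a set" where
  "carrier A = {q. 0 \<le> q \<and> (\<forall>p\<ge>0. p \<in> (\<Inter>n. A n) \<longrightarrow> inf p q = 0)}"

lemma carrierD: "q \<in> carrier A \<Longrightarrow> 0 \<le> p \<Longrightarrow> (\<And>n. p \<in> A n) \<Longrightarrow> inf p q = 0"
  by (auto simp: carrier_def)

lemma carrier_nonneg: "q \<in> carrier A \<Longrightarrow> 0 \<le> q"
  by (auto simp: carrier_def)

lemma carrier_mono: "(\<Inter>n. B n) \<subseteq> (\<Inter>n. A n) \<Longrightarrow> carrier A \<subseteq> carrier B"
  unfolding carrier_def by blast

lemma carrier_0: "0 \<in> carrier A"
  by (simp add: carrier_def inf_absorb2)

lemma carrier_add: "p \<in> carrier A \<Longrightarrow> q \<in> carrier A \<Longrightarrow> p + q \<in> carrier A"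
  by (simp add: carrier_def inf_add_eq_0)

lemma carrier_downward: "q \<in> carrier A \<Longrightarrow> 0 \<le> p \<Longrightarrow> p \<le> q \<Longrightarrow> p \<in> carrier A"
  unfolding carrier_def by (auto intro: inf_eq_0_mono)

lemma normal_seq_nhd: "normal_seq T A \<Longrightarrow> zero_nhd T (A n)"
  by (simp add: normal_seq_def)

lemma normal_seq_add: "normal_seq T A \<Longrightarrow> x \<in> A (Suc n) \<Longrightarrow> y \<in> A (Suc n) \<Longrightarrow> x + y \<in> A n"
  by (simp add: normal_seq_def)

lemma normal_seq_antimono:
  assumes "normal_seq T A" "m \<le> n"
  shows "A n \<subseteq> A m"
  using assms(2)
proof (rule lift_Suc_antimono_le[of A, rotated])
  fix k
  show "A (Suc k) \<subseteq> A k"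
    using normal_seq_add[OF assms(1), of _ k 0] zero_nhd_0[OF normal_seq_nhd[OF assms(1)]] by auto
qed

lemma normal_seq_Int:
  "normal_seq T A \<Longrightarrow> normal_seq T B \<Longrightarrow> normal_seq T (\<lambda>n. A n \<inter> B n)"
  by (simp add: normal_seq_def zero_nhd_Int)

lemma ex_normal_seq:
  assumes T: "locally_solid T" and V: "zero_nhd T V"
  obtains A where "normal_seq T A" "A 0 \<subseteq> V"
proof -
  have "\<exists>A. \<forall>n. (zero_nhd T (A n) \<and> (n = 0 \<longrightarrow> A n = V))
    \<and> (\<forall>x\<in>A (Suc n). \<forall>y\<in>A (Suc n). x + y \<in> A n)"
  proof (rule dependent_nat_choice)
    show "\<exists>W. zero_nhd T W \<and> (0 = (0::nat) \<longrightarrow> W = V)" using V by blast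
  next
    fix W and n :: nat assume "zero_nhd T W \<and> (n = 0 \<longrightarrow> W = V)"
    then show "\<exists>W'. (zero_nhd T W' \<and> (Suc n = 0 \<longrightarrow> W' = V)) \<and> (\<forall>x\<in>W'. \<forall>y\<in>W'. x + y \<in> W)"
      using zero_nhd_half[OF T, of W] by (metis nat.distinct(1))
  qed
  then obtain A where A: "\<And>n. zero_nhd T (A n)" "A 0 = V"
    "\<And>n. \<forall>x\<in>A (Suc n). \<forall>y\<in>A (Suc n). x + y \<in> A n" by blast
  then show thesis by (intro that[of A]) (simp_all add: normal_seq_def)
qed

text \<open>The null ideal and the carrier together span an order dense ideal, since whatever is
  disjoint from the null ideal lies in the carrier. Approximate \<open>x\<close> by
  \<open>p + q\<close> and drop the null part \<open>p\<close>, at the cost of one index.\<close>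

lemma carrier_approx:
  fixes T :: "'a::archimedean_vector_lattice topology"
  assumes T: "locally_solid T" "Lebesgue T" and A: "normal_seq T A" and x: "0 \<le> x"
  obtains q where "q \<in> carrier A" "q \<le> x" "x - q \<in> A n"
proof -
  define N where "N = {p. 0 \<le> p \<and> p \<in> (\<Inter>n. A n)}"
  have N_nonneg: "0 \<le> p" if "p \<in> N" for p using that by (simp add: N_def)
  have N_A: "p \<in> A k" if "p \<in> N" for p k using that by (simp add: N_def)
  have N_0: "0 \<in> N" using zero_nhd_0[OF normal_seq_nhd[OF A]] by (simp add: N_def)
  have N_add: "p + q \<in> N" if "p \<in> N" "q \<in> N" for p q
    using that normal_seq_add[OF A] by (simp add: N_def)
  have N_down: "p \<in> N" if "q \<in> N" "0 \<le> p" "p \<le> q" for p q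
    using that solid_nonneg[OF zero_nhd_solid[OF normal_seq_nhd[OF A]], of q _ p] by (simp add: N_def)
  define I where "I = {p + q |p q. p \<in> N \<and> q \<in> carrier A}"
  have II: "p + q \<in> I" if "p \<in> N" "q \<in> carrier A" for p q using that by (auto simp: I_def)
  obtain a where a: "a \<in> I" "a \<le> x" "x - a \<in> A (Suc n)"
  proof (rule Lebesgue_approx[OF T normal_seq_nhd[OF A, of "Suc n"] x])
    show "0 \<in> I" using II[OF N_0 carrier_0] by simp
  next
    fix a assume "a \<in> I" then show "0 \<le> a"
      using N_nonneg carrier_nonneg[of _ A] by (auto simp: I_def intro!: add_nonneg_nonneg)
  next
    fix a b assume "a \<in> I" "b \<in> I"
    then obtain p q p' q' where "a = p + q" "b = p' + q'"
      "p \<in> N" "q \<in> carrier A" "p' \<in> N" "q' \<in> carrier A" by (auto simp: I_def)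
    then show "a + b \<in> I"
      using II[OF N_add[of p p'] carrier_add[of q A q']] by (simp add: ac_simps)
  next
    fix a b assume "a \<in> I" and b: "0 \<le> b" "b \<le> a"
    then obtain p q where a: "a = p + q" "p \<in> N" "q \<in> carrier A" by (auto simp: I_def)
    \<comment> \<open>Riesz decomposition of \<open>b\<close> under \<open>p + q\<close>:
      \<open>inf b p\<close> is the part below \<open>p\<close>, and the remainder lies below
      \<open>q\<close>.\<close>
    have p: "inf b p \<in> N" using N_down[OF a(2)] N_nonneg[OF a(2)] b by simp
    have "b - q \<le> inf b p"
      using b(2) carrier_nonneg[OF a(3)] unfolding a(1) by (simp add: diff_le_eq)
    then have "b - inf b p \<le> q" by (metis add.commute diff_le_eq)
    then have "b - inf b p \<in> carrier A" using inf_le1[of b p] by (intro carrier_downward[OF a(3)]) (simp_all only: diff_ge_0_iff_ge)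
    then show "b \<in> I" using II[OF p] by (metis add.commute diff_add_cancel)
  next
    fix z assume z: "0 \<le> z" "\<And>a. a \<in> I \<Longrightarrow> inf z a = 0"
    have *: "inf z q = 0" if "q \<in> carrier A" for q using z(2)[OF II[OF N_0 that]] by simp
    have "z \<in> carrier A"
      using z(1) z(2)[OF II[OF _ carrier_0]] by (simp add: carrier_def N_def inf_commute)
    then show "z = 0" using *[of z] by simp
  qed blast
  then obtain p q where pq: "a = p + q" "p \<in> N" "q \<in> carrier A" by (auto simp: I_def)
  have "(x - a) + p \<in> A n" using normal_seq_add[OF A a(3) N_A[OF pq(2)]] .
  moreover have "q \<le> x" using a(2) N_nonneg[OF pq(2)] unfolding pq(1) by (meson add_increasing order_refl order_trans)
  ultimately show thesis using that[OF pq(3)] by (simp add: pq(1))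
qed

text \<open>The first summand and, by induction, the remaining sum both lie in
  \<open>A (Suc N)\<close>. The result is uniform in the number of summands.\<close>

lemma sum_mem_normal_seq:
  assumes A: "normal_seq T A" and q: "\<And>n. q n \<in> A n"
  shows "(\<Sum>i = Suc N..<Suc N + j. q i) \<in> A N"
proof (induction j arbitrary: N)
  case 0 then show ?case using zero_nhd_0[OF normal_seq_nhd[OF A]] by simp
next
  case (Suc j)
  have "(\<Sum>i = Suc N..<Suc N + Suc j. q i) = q (Suc N) + (\<Sum>i = Suc (Suc N)..<Suc (Suc N) + j. q i)"
    by (subst sum.atLeast_Suc_lessThan) simp_all
  then show ?case using normal_seq_add[OF A q Suc.IH] by simp
qed

text \<open>
  A lower bound \<open>c \<ge> 0\<close> of all eventual upper bounds of \<open>q\<^sub>n \<sqinter> w\<close> is \<open>0\<close>: the summability encoded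
  in a normal sequence puts \<open>c\<close> into each \<open>A N\<close>, so \<open>c\<close> is disjoint from each \<open>q\<^sub>n\<close>, and then \<open>b - c\<close>
  is an eventual upper bound whenever \<open>b\<close> is.
\<close>

lemma uo_converges_carrier:
  fixes T :: "'a::archimedean_vector_lattice topology"
  assumes T: "locally_solid T" "Lebesgue T" and A: "normal_seq T A"
    and q: "\<And>n. q n \<in> carrier A" "\<And>n. q n \<in> A n"
  shows "uo_converges UNIV (\<le>) q 0"
  unfolding uo_converges_def
proof (intro allI impI)
  fix w :: 'a assume w: "0 \<le> w"
  have q_nonneg: "0 \<le> q n" for n using carrier_nonneg[OF q(1)] .
  \<comment> \<open>Tail suprema need not exist; the set of all eventual upper bounds serves as the
    dominating net instead.\<close>
  define E where "E = {b. \<exists>N. \<forall>n\<ge>N. inf (q n) w \<le> b}"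
  have EI: "b \<in> E" if "\<And>n. n \<ge> N \<Longrightarrow> inf (q n) w \<le> b" for b N
    using that by (auto simp: E_def)
  have EE: thesis if "b \<in> E" "\<And>N. (\<And>n. n \<ge> N \<Longrightarrow> inf (q n) w \<le> b) \<Longrightarrow> thesis" for b thesis
    using that by (auto simp: E_def)
  have inf_nonneg: "0 \<le> inf (q n) w" for n using q_nonneg w by simp
  have E_nonneg: "0 \<le> b" if "b \<in> E" for b
    using that by (rule EE) (meson inf_nonneg order_refl order_trans)
  have w_E: "w \<in> E" using EI[of 0 w] by simp
  have dir: "directed_set E (\<lambda>a b. b \<le> a)"
    unfolding directed_set_def
  proof (intro conjI ballI impI)
    show "E \<noteq> {}" using w_E by blast
  next
    fix a b assume "a \<in> E" "b \<in> E"
    then obtain N M where N: "\<And>n. n \<ge> N \<Longrightarrow> inf (q n) w \<le> a"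
      and M: "\<And>n. n \<ge> M \<Longrightarrow> inf (q n) w \<le> b" by (metis EE)
    have "inf a b \<in> E" by (rule EI[of "max N M"]) (rule le_infI[OF N M]; simp)
    then show "\<exists>c\<in>E. c \<le> a \<and> c \<le> b" by (meson inf_le1 inf_le2)
  qed auto
  have "decreases_to_zero E (\<lambda>a b. b \<le> a) (\<lambda>b. b)"
    unfolding decreases_to_zero_def
  proof (intro conjI allI impI)
    fix z assume z: "\<forall>b\<in>E. z \<le> b"
    define c where "c = sup z 0"
    have c: "0 \<le> c" "c \<le> b" if "b \<in> E" for b using z E_nonneg that by (auto simp: c_def)
    have c0: "0 \<le> c" by (simp add: c_def)
    have "c \<in> A N" for N
    proof -
      \<comment> \<open>Truncated partial sums and everything positive below them. Starting at
        \<open>Suc (Suc N)\<close> keeps them in \<open>A (Suc N)\<close>, so that \<open>s\<close>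
        and \<open>b - s\<close> add up to an element of \<open>A N\<close>.\<close>
      define F where "F = {s. 0 \<le> s \<and> s \<le> w \<and> (\<exists>j. s \<le> (\<Sum>i = Suc (Suc N)..<Suc (Suc N) + j. q i))}"
      have "0 \<in> F" unfolding F_def using w by (auto intro!: exI[of _ 0])
      obtain b s where bs: "s \<in> F" "\<And>a. a \<in> F \<Longrightarrow> a \<le> b" "b - s \<in> A (Suc N)"
      proof (rule Lebesgue_upper_bound[OF T normal_seq_nhd[OF A, of "Suc N"]])
        show "F \<noteq> {}" using \<open>0 \<in> F\<close> by blast
        show "a \<le> w" if "a \<in> F" for a using that by (simp add: F_def)
      next
        fix a b assume "a \<in> F" "b \<in> F"
        then obtain j k where jk: "0 \<le> a" "a \<le> w" "b \<le> w"
          "a \<le> (\<Sum>i = Suc (Suc N)..<Suc (Suc N) + j. q i)"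
          "b \<le> (\<Sum>i = Suc (Suc N)..<Suc (Suc N) + k. q i)" by (auto simp: F_def)
        have mono: "(\<Sum>i = Suc (Suc N)..<Suc (Suc N) + j. q i)
            \<le> (\<Sum>i = Suc (Suc N)..<Suc (Suc N) + m. q i)" if "j \<le> m" for j m
          using that q_nonneg by (intro sum_mono2) auto
        have "sup a b \<le> (\<Sum>i = Suc (Suc N)..<Suc (Suc N) + max j k. q i)"
          using order_trans[OF jk(4) mono[of j "max j k"]] order_trans[OF jk(5) mono[of k "max j k"]]
          by (intro le_supI) simp_all
        moreover have "0 \<le> sup a b" using jk(1) by (rule le_supI1)
        moreover have "sup a b \<le> w" using jk(2,3) by (rule le_supI)
        ultimately have "sup a b \<in> F" unfolding F_def by blast
        then show "\<exists>c\<in>F. a \<le> c \<and> b \<le> c" by (meson sup_ge1 sup_ge2)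
      qed blast
      have "inf (q n) w \<in> F" if n: "n \<ge> Suc (Suc N)" for n
      proof -
        \<comment> \<open>The length \<open>n - Suc N\<close> makes \<open>n\<close> the last index
          of the sum.\<close>
        have "q n \<le> (\<Sum>i = Suc (Suc N)..<Suc (Suc N) + (n - Suc N). q i)"
          using n q_nonneg sum_mono2[of "{Suc (Suc N)..<Suc (Suc N) + (n - Suc N)}" "{n}" q] by auto
        then have "inf (q n) w \<le> (\<Sum>i = Suc (Suc N)..<Suc (Suc N) + (n - Suc N). q i)"
          by (rule le_infI1)
        then show ?thesis using inf_nonneg[of n] inf_le2[of "q n" w] unfolding F_def by blast
      qed
      then have "b \<in> E" using bs(2) by (intro EI[of "Suc (Suc N)"]) blast
      obtain j where s: "0 \<le> s" "s \<le> (\<Sum>i = Suc (Suc N)..<Suc (Suc N) + j. q i)"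
        using bs(1) by (auto simp: F_def)
      have "s \<in> A (Suc N)"
        using solid_nonneg[OF zero_nhd_solid[OF normal_seq_nhd[OF A]] sum_mem_normal_seq[OF A q(2)] s] .
      then have "(b - s) + s \<in> A N" by (rule normal_seq_add[OF A bs(3)])
      then show "c \<in> A N"
        using solid_nonneg[OF zero_nhd_solid[OF normal_seq_nhd[OF A]], of b N c] c[OF \<open>b \<in> E\<close>] by simp
    qed
    then have disj: "inf c (q n) = 0" for n by (rule carrierD[OF q(1) c0])
    have "c = 0"
    proof (rule multiples_bounded_imp_zero[where P = "\<lambda>b. b \<in> E" and y = w and z = 0])
      fix b assume b: "b \<in> E"
      obtain N where N: "\<And>n. n \<ge> N \<Longrightarrow> inf (q n) w \<le> b" using b by (metis EE)
      have "inf (q n) w \<le> b - c" if "n \<ge> N" for n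
      proof -
        have "inf c (inf (q n) w) = 0"
          using inf_eq_0_mono[OF disj[of n] c0 inf_nonneg order_refl inf_le1] .
        then have "c + inf (q n) w \<le> b" using c(2)[OF b] N[OF that] by (rule disjoint_add_le)
        then show ?thesis by (simp add: algebra_simps)
      qed
      then show "b - c \<in> E" by (rule EI)
    qed (use c0 w_E E_nonneg in simp_all)
    then show "z \<le> 0" unfolding c_def by (metis sup_ge1)
  qed (use E_nonneg in auto)
  then show "order_converges UNIV (\<le>) (\<lambda>n. inf \<bar>q n - 0\<bar> w) 0"
  proof (rule order_convergesI[OF dir])
    fix b assume "b \<in> E"
    then show "\<exists>n0\<in>UNIV. \<forall>n\<in>UNIV. n0 \<le> n \<longrightarrow> \<bar>inf \<bar>q n - 0\<bar> w - 0\<bar> \<le> b"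
      using q_nonneg inf_nonneg by (auto simp: abs_of_nonneg E_def)
  qed
qed


section \<open>Minimal and uo-Lebesgue topologies\<close>

lemma coarser_Lebesgue:
  fixes T T1 :: "'a::vector_lattice topology"
  assumes T: "locally_solid T" "Lebesgue T" and T1: "locally_solid T1"
    and coarser: "\<And>U. openin T1 U \<Longrightarrow> openin T U"
  shows "Lebesgue T1"
  unfolding Lebesgue_def
proof (intro allI impI)
  fix D le and x :: "'a index \<Rightarrow> 'a"
  assume "directed_set D le" "order_converges D le x 0"
  then have "limitin T x 0 (net_filter D le)" using T(2) by (simp add: Lebesgue_def)
  then show "limitin T1 x 0 (net_filter D le)"
    using coarser by (simp add: limitin_def locally_solid_topspace[OF T1])
qed

text \<open>The carriers of all normal sequences of \<open>T1\<close> together form the positive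
  cone of an order dense ideal. Sums are handled by intersecting two sequences. If \<open>z\<close>
  is disjoint from every carrier, then each approximation of \<open>z\<close> by
  \<open>carrier_approx\<close> is zero, so \<open>z\<close> lies in every
  \<open>T1\<close>-neighbourhood and vanishes. The final approximation takes place in
  \<open>T\<close>.\<close>

lemma union_carriers_approx:
  fixes T T1 :: "'a::archimedean_vector_lattice topology"
  assumes T: "locally_solid T" "Lebesgue T"
    and T1: "locally_solid T1" "Lebesgue T1" "Hausdorff_space T1"
    and V: "zero_nhd T V" and x: "0 \<le> x"
  obtains A q where "normal_seq T1 A" "q \<in> carrier A" "q \<le> x" "x - q \<in> V"
proof -
  define I where "I = {q. \<exists>A. normal_seq T1 A \<and> q \<in> carrier A}"
  have II: "q \<in> I" if "normal_seq T1 A" "q \<in> carrier A" for A q using that by (auto simp: I_def)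
  obtain q where "q \<in> I" "q \<le> x" "x - q \<in> V"
  proof (rule Lebesgue_approx[OF T V x])
    obtain A where "normal_seq T1 A" using ex_normal_seq[OF T1(1) zero_nhd_UNIV[OF T1(1)]] by metis
    then show "0 \<in> I" using carrier_0 by (rule II)
  next
    fix a assume "a \<in> I" then show "0 \<le> a" using carrier_nonneg by (auto simp: I_def)
  next
    fix a b assume "a \<in> I" "b \<in> I"
    then obtain A B where A: "normal_seq T1 A" "a \<in> carrier A" and B: "normal_seq T1 B" "b \<in> carrier B"
      by (auto simp: I_def)
    have "carrier A \<subseteq> carrier (\<lambda>n. A n \<inter> B n)" "carrier B \<subseteq> carrier (\<lambda>n. A n \<inter> B n)"
      by (rule carrier_mono; blast)+
    then show "a + b \<in> I" using A B by (intro II[OF normal_seq_Int[OF A(1) B(1)] carrier_add]) auto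
  next
    fix a b assume "a \<in> I" "0 \<le> b" "b \<le> a"
    then show "b \<in> I" unfolding I_def using carrier_downward by blast
  next
    fix z assume z: "0 \<le> z" "\<And>a. a \<in> I \<Longrightarrow> inf z a = 0"
    have "z \<in> W" if W: "zero_nhd T1 W" for W
    proof -
      obtain A where A: "normal_seq T1 A" "A 0 \<subseteq> W" using ex_normal_seq[OF T1(1) W] by metis
      obtain q where q: "q \<in> carrier A" "q \<le> z" "z - q \<in> A 0"
        using carrier_approx[OF T1(1,2) A(1) z(1)] by metis
      have "q = 0" using z(2)[OF II[OF A(1) q(1)]] q(2) by (simp add: inf_absorb2)
      then show ?thesis using q A(2) by auto
    qed
    then show "z = 0" using T1(3) Hausdorff_iff_zero_nhd[OF T1(1)] by blast
  qed blast
  then show thesis using that by (auto simp: I_def)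
qed

lemma uo_Lebesgue_imp_Lebesgue:
  fixes T :: "'a::vector_lattice topology"
  assumes "uo_Lebesgue T"
  shows "Lebesgue T"
  unfolding Lebesgue_def
proof (intro allI impI)
  fix D le and x :: "'a index \<Rightarrow> 'a"
  assume D: "directed_set D le" and "order_converges D le x 0"
  then obtain E leE and y :: "'a index \<Rightarrow> 'a" where y: "directed_set E leE" "decreases_to_zero E leE y"
    "\<And>b. b \<in> E \<Longrightarrow> \<exists>a0\<in>D. \<forall>a\<in>D. le a0 a \<longrightarrow> \<bar>x a - 0\<bar> \<le> y b"
    unfolding order_converges_def by blast
  have "uo_converges D le x 0"
    unfolding uo_converges_def
  proof (intro allI impI order_convergesI[OF y(1,2)])
    fix u :: 'a and b assume u: "0 \<le> u" and "b \<in> E"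
    then obtain a0 where "a0 \<in> D" "\<forall>a\<in>D. le a0 a \<longrightarrow> \<bar>x a - 0\<bar> \<le> y b" using y(3) by blast
    moreover have "\<bar>inf \<bar>x a - 0\<bar> u - 0\<bar> \<le> \<bar>x a - 0\<bar>" for a using u by (simp add: abs_of_nonneg)
    ultimately show "\<exists>a0\<in>D. \<forall>a\<in>D. le a0 a \<longrightarrow> \<bar>inf \<bar>x a - 0\<bar> u - 0\<bar> \<le> y b"
      by (meson order_trans)
  qed
  then show "limitin T x 0 (net_filter D le)" using assms D by (simp add: uo_Lebesgue_def)
qed

lemma Lebesgue_unbounded_imp_uo_Lebesgue:
  fixes T :: "'a::vector_lattice topology"
  assumes T: "locally_solid T" "Lebesgue T" "unbounded_topology T"
  shows "uo_Lebesgue T"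
  unfolding uo_Lebesgue_def
proof (intro allI impI)
  fix D le and x :: "'a index \<Rightarrow> 'a"
  assume "directed_set D le" "uo_converges D le x 0"
  then have "limitin (u_topology T) x 0 (net_filter D le)"
    unfolding limitin_u_topology[OF T(1)] uo_converges_def by (blast intro: LebesgueD[OF T(2)])
  then show "limitin T x 0 (net_filter D le)" using T(3) by (simp add: unbounded_topology_def)
qed

section \<open>From uo-Lebesgue to minimal\<close>

lemma uo_Lebesgue_imp_minimal:
  fixes T :: "'a::archimedean_vector_lattice topology"
  assumes T: "locally_solid T" "Hausdorff_space T" "uo_Lebesgue T"
  shows "minimal_topology T"
  unfolding minimal_topology_def
proof (intro conjI allI impI T)
  fix T1 :: "'a topology"
  assume "locally_solid T1 \<and> Hausdorff_space T1 \<and> (\<forall>U. openin T1 U \<longrightarrow> openin T U)"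
  then have T1: "locally_solid T1" "Hausdorff_space T1" "\<And>U. openin T1 U \<Longrightarrow> openin T U" by blast+
  have L: "Lebesgue T" using T(3) by (rule uo_Lebesgue_imp_Lebesgue)
  have L1: "Lebesgue T1" using coarser_Lebesgue[OF T(1) L T1(1,3)] .
  have "zero_nhd T1 V" if V: "zero_nhd T V" for V
  proof (rule ccontr)
    assume V1: "\<not> zero_nhd T1 V"
    have not_subset: "\<exists>x\<in>W. x \<notin> V" if "zero_nhd T1 W" for W
      using that V1 zero_nhd_solid[OF V] unfolding zero_nhd_def by blast
    obtain V' where V': "zero_nhd T V'" "\<And>x y. x \<in> V' \<Longrightarrow> y \<in> V' \<Longrightarrow> x + y \<in> V"
      using zero_nhd_half[OF T(1) V] by metis
    \<comment> \<open>Each stage is a whole normal sequence. The witness is small for the old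
      sequence and lies in the carrier of the refined one.\<close>
    have "\<exists>A. \<forall>n. normal_seq T1 (A n) \<and> ((\<forall>k. A (Suc n) k \<subseteq> A n k)
        \<and> (\<exists>q. q \<in> carrier (A (Suc n)) \<and> q \<in> A n n \<and> q \<notin> V'))"
    proof (rule dependent_nat_choice)
      show "\<exists>A. normal_seq T1 A" using ex_normal_seq[OF T1(1) zero_nhd_UNIV[OF T1(1)]] by metis
    next
      fix A and n :: nat assume A: "normal_seq T1 A"
      then obtain x where "x \<in> A n" "x \<notin> V" using not_subset[OF normal_seq_nhd[OF A]] by blast
      then have x: "\<bar>x\<bar> \<in> A n" "\<bar>x\<bar> \<notin> V"
        using solid_abs_iff zero_nhd_solid[OF V] zero_nhd_solid[OF normal_seq_nhd[OF A]] by blast+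
      obtain S q where q: "normal_seq T1 S" "q \<in> carrier S" "q \<le> \<bar>x\<bar>" "\<bar>x\<bar> - q \<in> V'"
        using union_carriers_approx[OF T(1) L T1(1) L1 T1(2) V'(1) abs_ge_zero] by metis
      have "q \<in> A n"
        using solid_nonneg[OF zero_nhd_solid[OF normal_seq_nhd[OF A]] x(1) carrier_nonneg[OF q(2)] q(3)] .
      \<comment> \<open>Otherwise \<open>(\<bar>x\<bar> - q) + q\<close> would lie in
        \<open>V\<close>.\<close>
      moreover have "q \<notin> V'" using V'(2)[OF q(4)] x(2) by force
      moreover have "q \<in> carrier (\<lambda>k. A k \<inter> S k)"
        using q(2) carrier_mono[of "\<lambda>k. A k \<inter> S k" S] by blast
      ultimately show "\<exists>B. normal_seq T1 B \<and> ((\<forall>k. B k \<subseteq> A k) \<and> (\<exists>q. q \<in> carrier B \<and> q \<in> A n \<and> q \<notin> V'))"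
        using normal_seq_Int[OF A q(1)] by (intro exI[of _ "\<lambda>k. A k \<inter> S k"]) blast
    qed
    then obtain A where A: "\<And>n. normal_seq T1 (A n)" "\<And>n k. A (Suc n) k \<subseteq> A n k"
      "\<And>n. \<exists>q. q \<in> carrier (A (Suc n)) \<and> q \<in> A n n \<and> q \<notin> V'" by blast
    obtain q where q: "\<And>n. q n \<in> carrier (A (Suc n))" "\<And>n. q n \<in> A n n" "\<And>n. q n \<notin> V'"
      using A(3) by metis
    have A_antimono: "A n k \<subseteq> A m k" if "m \<le> n" for m n k
      using A(2) that by (rule lift_Suc_antimono_le[of "\<lambda>n. A n k"])
    \<comment> \<open>Two elements of \<open>A (Suc n) (Suc n)\<close> add up into
      \<open>A (Suc n) n\<close>, which is contained in \<open>A n n\<close>.\<close>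
    have diag: "normal_seq T1 (\<lambda>n. A n n)"
      using A(1) A(2) unfolding normal_seq_def by blast
    \<comment> \<open>The diagonal has the smallest null ideal, so its carrier contains the carriers
      of all stages and thus every \<open>q n\<close>.\<close>
    have "(\<Inter>n. A n n) \<subseteq> A m k" for m k
      using A_antimono[of m "max m k" "max m k"] normal_seq_antimono[OF A(1), of k "max m k" m] by fastforce
    then have "carrier (A m) \<subseteq> carrier (\<lambda>n. A n n)" for m by (intro carrier_mono) blast
    then have "uo_converges UNIV (\<le>) q 0"
      using q(1) by (intro uo_converges_carrier[OF T1(1) L1 diag _ q(2)]) blast
    moreover have dir: "directed_set UNIV ((\<le>) :: nat \<Rightarrow> _)"
      unfolding directed_set_def by (auto intro: max.cobounded1 max.cobounded2)
    ultimately have "limitin T q 0 (net_filter UNIV (\<le>))" by (intro uo_LebesgueD[OF T(3)])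
    then show False
      using V'(1) q(3) by (auto simp: limitin_iff_zero_nhd[OF T(1)] eventually_net_filter[OF dir])
  qed
  then have "\<forall>U. openin T U \<longrightarrow> openin T1 U"
    using openin_mono_iff_zero_nhd[OF T(1) T1(1)] by blast
  then show "T1 = T" using T1(3) by (auto simp: topology_eq)
qed

section \<open>From minimal to Lebesgue and unbounded\<close>

text \<open>A single member in \<open>V\<close> suffices for convergence, since \<open>V\<close> is
  solid and contains whatever that member dominates.\<close>

lemma minimal_decreasing_net:
  fixes T :: "'a::vector_lattice topology"
  assumes T: "minimal_topology T" and E: "directed_set E le" and y: "decreases_to_zero E le y"
    and V: "zero_nhd T V"
  obtains b where "b \<in> E" "y b \<in> V"
proof -
  have ls: "locally_solid T" and H: "Hausdorff_space T" using T by (auto simp: minimal_topology_def)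
  obtain V' where V': "zero_nhd T V'" "\<And>x y. x \<in> V' \<Longrightarrow> y \<in> V' \<Longrightarrow> x + y \<in> V"
    using zero_nhd_half[OF ls V] by metis
  obtain b0 where b0: "b0 \<in> E" using E by (auto simp: directed_set_def)
  have y_nonneg: "0 \<le> y b" if "b \<in> E" for b using y that by (simp add: decreases_to_zero_def)
  have y_dir: "\<exists>c\<in>E. y c \<le> y a \<and> y c \<le> y b" if "a \<in> E" "b \<in> E" for a b
    using E y that unfolding directed_set_def decreases_to_zero_def by meson
  define x where "x = y b0"
  have x: "0 \<le> x" using y_nonneg[OF b0] by (simp add: x_def)
  \<comment> \<open>This disposes of one half of \<open>y b \<le> p b + e x\<close>; it remains to
    find \<open>b\<close> with \<open>p b\<close> in \<open>V'\<close>.\<close>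
  obtain e where e: "0 < e" "e *\<^sub>R x \<in> V'" using zero_nhd_absorbs[OF ls V'(1)] by metis
  have ex: "0 \<le> e *\<^sub>R x" using e x by (simp add: scaleR_nonneg_nonneg)
  define p where "p b = sup (y b - e *\<^sub>R x) 0" for b
  have p_nonneg: "0 \<le> p b" for b by (simp add: p_def)
  have p_mono: "p c \<le> p b" if "y c \<le> y b" for b c
    unfolding p_def using that by (intro sup_mono diff_mono) auto
  \<comment> \<open>Truncation by a member of \<open>G\<close> annihilates some \<open>p b\<close>,
    so every neighbourhood of zero in the topology built from \<open>G\<close> contains some
    \<open>p b\<close>.\<close>
  define G where "G = {a. 0 \<le> a \<and> (\<exists>b\<in>E. inf (p b) a = 0)}"
  have GI: "a \<in> G" if "0 \<le> a" "b \<in> E" "inf (p b) a = 0" for a b using that by (auto simp: G_def)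
  have G_nonneg: "0 \<le> a" if "a \<in> G" for a using that by (simp add: G_def)
  have G_0: "0 \<in> G" using p_nonneg b0 by (intro GI[of _ b0]) (auto simp: inf_absorb2)
  have G_add: "a + a' \<in> G" if aa': "a \<in> G" "a' \<in> G" for a a'
  proof -
    obtain b b' where b: "0 \<le> a" "0 \<le> a'" "b \<in> E" "b' \<in> E" "inf (p b) a = 0" "inf (p b') a' = 0"
      using aa' unfolding G_def by blast
    obtain c where c: "c \<in> E" "y c \<le> y b" "y c \<le> y b'" using y_dir[OF b(3,4)] by blast
    have "inf (p c) a = 0" "inf (p c) a' = 0"
      using inf_eq_0_mono[OF b(5) p_nonneg b(1) p_mono[OF c(2)]]
        inf_eq_0_mono[OF b(6) p_nonneg b(2) p_mono[OF c(3)]] by simp_all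
    then show ?thesis using b(1,2) c(1) by (intro GI[of _ c] inf_add_eq_0 p_nonneg add_nonneg_nonneg)
  qed
  obtain S where S: "locally_solid S"
    "\<And>W a. zero_nhd T W \<Longrightarrow> a \<in> G \<Longrightarrow> zero_nhd S {x. inf \<bar>x\<bar> a \<in> W}"
    "\<And>V. zero_nhd S V \<Longrightarrow> \<exists>W a. zero_nhd T W \<and> a \<in> G \<and> {x. inf \<bar>x\<bar> a \<in> W} \<subseteq> V"
    using ex_unbounded_topology_wrt[OF ls G_0 G_nonneg G_add] by metis
  have "Hausdorff_space S"
    unfolding Hausdorff_iff_zero_nhd[OF S(1)]
  proof (intro allI impI)
    fix v assume v: "\<forall>V. zero_nhd S V \<longrightarrow> v \<in> V"
    define z where "z = \<bar>v\<bar>"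
    have z: "0 \<le> z" by (simp add: z_def)
    have z_G: "inf z a = 0" if "a \<in> G" for a
      using H v S(2)[OF _ that] unfolding Hausdorff_iff_zero_nhd[OF ls] z_def by blast
    \<comment> \<open>The negative part of \<open>y b - e x\<close> belongs to \<open>G\<close>, so
      it is disjoint from \<open>z\<close>. It and the infimum of \<open>z\<close> and
      \<open>e x\<close> are therefore disjoint elements below \<open>e x\<close>, and their sum is
      still below \<open>e x\<close>.\<close>
    have "inf z (e *\<^sub>R x) \<le> y b" if b: "b \<in> E" for b
    proof -
      have "inf (p b) (sup (e *\<^sub>R x - y b) 0) = 0" unfolding p_def by (rule inf_pos_neg_parts_eq_0)
      then have "sup (e *\<^sub>R x - y b) 0 \<in> G" using b by (intro GI) auto
      then have "inf (inf z (e *\<^sub>R x)) (sup (e *\<^sub>R x - y b) 0) = 0"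
        using z ex by (intro inf_eq_0_mono[OF z_G]) auto
      then have "inf z (e *\<^sub>R x) + sup (e *\<^sub>R x - y b) 0 \<le> e *\<^sub>R x"
        using ex y_nonneg[OF b] by (intro disjoint_add_le) auto
      then have "inf z (e *\<^sub>R x) + (e *\<^sub>R x - y b) \<le> e *\<^sub>R x"
        by (rule order_trans[rotated]) (intro add_left_mono sup_ge1)
      then show ?thesis by (simp add: algebra_simps)
    qed
    then have "inf z (e *\<^sub>R x) \<le> 0" using y by (simp add: decreases_to_zero_def)
    \<comment> \<open>\<open>n\<close> has to be at least 1 for \<open>inf_scaleR_le\<close>, and
      \<open>n * e\<close> at least 1 to dominate \<open>x\<close>.\<close>
    define n where "n = max 1 (1 / e)"
    have "1 *\<^sub>R x \<le> (n * e) *\<^sub>R x"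
      using e x by (intro scaleR_right_mono) (auto simp: n_def field_simps max_def)
    then have "inf x z \<le> inf (n *\<^sub>R (e *\<^sub>R x)) z" by (intro inf_mono) auto
    also have "\<dots> \<le> n *\<^sub>R inf (e *\<^sub>R x) z" using z by (intro inf_scaleR_le) (auto simp: n_def)
    also have "\<dots> \<le> n *\<^sub>R 0"
      using \<open>inf z (e *\<^sub>R x) \<le> 0\<close> by (intro scaleR_left_mono) (auto simp: n_def inf_commute)
    finally have "inf x z = 0" using x z by (intro antisym) auto
    \<comment> \<open>Here it matters that \<open>x\<close> is itself a member of the net:
      \<open>z\<close> is disjoint from \<open>x\<close>, hence from \<open>p b0\<close>, so it
      belongs to \<open>G\<close> and is disjoint from itself.\<close>
    moreover have "p b0 \<le> x" unfolding p_def using x ex by (simp add: x_def)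
    ultimately have "inf (p b0) z = 0"
      by (rule inf_eq_0_mono[OF _ p_nonneg z _ order_refl])
    then have "z \<in> G" using z b0 by (intro GI)
    then show "v = 0" using z_G[of z] by (simp add: z_def)
  qed
  moreover have "zero_nhd T W" if W: "zero_nhd S W" for W
  proof -
    obtain W' a where W': "zero_nhd T W'" "a \<in> G" "{x. inf \<bar>x\<bar> a \<in> W'} \<subseteq> W"
      using S(3)[OF W] by blast
    have "inf \<bar>x\<bar> a \<in> W'" if "x \<in> W'" for x
      using solid_nonneg[OF zero_nhd_solid[OF W'(1)], of "\<bar>x\<bar>"] that G_nonneg[OF W'(2)]
        solid_abs_iff[OF zero_nhd_solid[OF W'(1)]] by simp
    then have "W' \<subseteq> W" using W'(3) by blast
    then show ?thesis using W'(1) zero_nhd_solid[OF W] unfolding zero_nhd_def by (meson order_trans)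
  qed
  then have "\<forall>U. openin S U \<longrightarrow> openin T U"
    using openin_mono_iff_zero_nhd[OF S(1) ls] by blast
  ultimately have "S = T" using T S(1) by (simp add: minimal_topology_def)
  \<comment> \<open>Since the topologies agree, \<open>V'\<close> contains a basic neighbourhood of
    \<open>S\<close>, and with it some \<open>p b\<close>.\<close>
  then obtain W a where W: "zero_nhd T W" "a \<in> G" "{x. inf \<bar>x\<bar> a \<in> W} \<subseteq> V'"
    using S(3) V'(1) by blast
  then obtain b where b: "b \<in> E" "inf (p b) a = 0" by (auto simp: G_def)
  then have "p b \<in> V'" using W(3) zero_nhd_0[OF W(1)] p_nonneg[of b] by (auto simp: abs_of_nonneg)
  then have "p b + e *\<^sub>R x \<in> V" using e(2) by (rule V'(2))
  moreover have "y b \<le> p b + e *\<^sub>R x" by (metis p_def diff_le_eq sup_ge1)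
  ultimately have "y b \<in> V" using solid_nonneg[OF zero_nhd_solid[OF V]] y_nonneg[OF b(1)] by blast
  then show thesis using b(1) by (rule that[rotated])
qed

lemma minimal_imp_Lebesgue:
  fixes T :: "'a::vector_lattice topology"
  assumes T: "minimal_topology T"
  shows "Lebesgue T"
  unfolding Lebesgue_def
proof (intro allI impI)
  fix D le and x :: "'a index \<Rightarrow> 'a"
  assume D: "directed_set D le" and "order_converges D le x 0"
  then obtain E leE and y :: "'a index \<Rightarrow> 'a" where y: "directed_set E leE" "decreases_to_zero E leE y"
    "\<And>b. b \<in> E \<Longrightarrow> \<exists>a0\<in>D. \<forall>a\<in>D. le a0 a \<longrightarrow> \<bar>x a - 0\<bar> \<le> y b"
    unfolding order_converges_def by blast
  have ls: "locally_solid T" using T by (simp add: minimal_topology_def)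
  show "limitin T x 0 (net_filter D le)"
    unfolding limitin_iff_zero_nhd[OF ls] eventually_net_filter[OF D]
  proof (intro allI impI)
    fix V assume V: "zero_nhd T V"
    obtain b where b: "b \<in> E" "y b \<in> V" using minimal_decreasing_net[OF T y(1,2) V] by metis
    have "x a - 0 \<in> V" if "\<bar>x a - 0\<bar> \<le> y b" for a
      using solidD[OF zero_nhd_solid[OF V] b(2)] that abs_ge_self order_trans by blast
    then show "\<exists>a\<in>D. \<forall>b\<in>D. le a b \<longrightarrow> x b - 0 \<in> V" using y(3)[OF b(1)] by blast
  qed
qed

text \<open>Truncation only shrinks absolute values, so \<open>u_topology T\<close> is coarser than
  \<open>T\<close>. It is Hausdorff because truncating at the absolute value of \<open>v\<close>
  loses nothing of \<open>v\<close>.\<close>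

lemma minimal_imp_unbounded:
  fixes T :: "'a::vector_lattice topology"
  assumes T: "minimal_topology T"
  shows "unbounded_topology T"
proof -
  have ls: "locally_solid T" and H: "Hausdorff_space T" using T by (auto simp: minimal_topology_def)
  define S where "S = u_topology T"
  have S: "locally_solid S"
    using is_u_topology_u_topology[OF ls] by (simp add: is_u_topology_def S_def)
  have lim: "limitin S x l F \<longleftrightarrow> (\<forall>u\<ge>0. limitin T (\<lambda>a. inf \<bar>x a - l\<bar> u) 0 F)"
    for x l and F :: "'b filter" unfolding S_def by (rule limitin_u_topology[OF ls])
  have "Hausdorff_space S"
    unfolding Hausdorff_iff_zero_nhd[OF S]
  proof (intro allI impI)
    fix v assume v: "\<forall>V. zero_nhd S V \<longrightarrow> v \<in> V"
    \<comment> \<open>\<open>S\<close> is known through its convergent nets, so \<open>v\<close> is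
      tested by a constant sequence.\<close>
    then have "limitin S (\<lambda>_. v) 0 sequentially" by (simp add: limitin_iff_zero_nhd[OF S])
    then have "limitin T (\<lambda>_. inf \<bar>v - 0\<bar> \<bar>v\<bar>) 0 sequentially"
      unfolding lim using abs_ge_zero by blast
    then have "\<bar>v\<bar> \<in> V" if "zero_nhd T V" for V using that by (simp add: limitin_iff_zero_nhd[OF ls])
    then show "v = 0" using H unfolding Hausdorff_iff_zero_nhd[OF ls] by fastforce
  qed
  moreover have "openin T U" if U: "openin S U" for U
  proof (rule topology_eq_if_nets_converge[OF _ _ _ U])
    fix D le and x :: "'a index \<Rightarrow> 'a" and l
    assume x: "limitin T x l (net_filter D le)"
    show "limitin S x l (net_filter D le)"
      unfolding lim limitin_iff_zero_nhd[OF ls]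
    proof (intro allI impI)
      fix u :: 'a and V assume u: "0 \<le> u" and V: "zero_nhd T V"
      have "inf \<bar>v\<bar> u - 0 \<in> V" if "v \<in> V" for v
        using solid_nonneg[OF zero_nhd_solid[OF V], of "\<bar>v\<bar>"] that u
          solid_abs_iff[OF zero_nhd_solid[OF V]] by simp
      moreover have "eventually (\<lambda>a. x a - l \<in> V) (net_filter D le)"
        using x V unfolding limitin_iff_zero_nhd[OF ls] by blast
      ultimately show "eventually (\<lambda>a. inf \<bar>x a - l\<bar> u - 0 \<in> V) (net_filter D le)"
        by (rule eventually_mono[rotated])
    qed
  qed (simp_all add: locally_solid_topspace ls S)
  ultimately have "S = T" using T S by (simp add: minimal_topology_def)
  then show ?thesis by (simp add: unbounded_topology_def S_def)
qed

theorem theorem6p4: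
  fixes \<tau> :: "'a::archimedean_vector_lattice topology"
  assumes "locally_solid \<tau>" and "Hausdorff_space \<tau>"
  shows "(uo_Lebesgue \<tau> \<longleftrightarrow> Lebesgue \<tau> \<and> unbounded_topology \<tau>)
    \<and> (Lebesgue \<tau> \<and> unbounded_topology \<tau> \<longleftrightarrow> minimal_topology \<tau>)"
  using uo_Lebesgue_imp_minimal[OF assms] minimal_imp_Lebesgue[of \<tau>] minimal_imp_unbounded[of \<tau>]
    Lebesgue_unbounded_imp_uo_Lebesgue[OF assms(1)] by blast

end
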